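(* Under the standing assumptions of the context, let $\{\hat{\mathbf b}^t\}$ be the minimizer of the real-time problem (the real-time decisions), and $\{\tilde{\mathbf b}^t\}$ the minimizer of the offline aggregate problem, which is also the sought generalized Nash equilibrium. Then $$\lim_{T\to\infty}\frac1T\sum_{t=0}^{T-1}\mathbb E\big[\|\hat{\mathbf b}^t-\tilde{\mathbf b}^t\|_2^2\big]\le\frac{2K}{\underline c_p},\qquad\text{where } K:=\frac12\sum_{n=1}^Nw_n\max\{\overline b_n^2,\underline b_n^2\}.$$
   Context: Setting. There are $N$ users (one per bus of a radial distribution grid), indexed by $n$, and time periods $t=0,1,2,\dots$. Vector inequalities are entrywise, and $\mathbf 1$ is the all-one vector. At time $t$: $\boldsymbol\ell^t,\mathbf q^t\in\mathbb R^N$ are the (random) active and reactive loads, bounded within known intervals $\underline{\boldsymbol\ell}\le\boldsymbol\ell^t\le\overline{\boldsymbol\ell}$ and $\underline{\mathbf q}\le\mathbf q^t\le\overline{\mathbf q}$; $r^t\in\{-1,+1\}$ is the (random) regulation signal; the (random) prices satisfy $0\le\underline c_0\le c_0^t\le\overline c_0$, $0\le\underline c_p\le c_p^t\le\overline c_p$ (with $\underline c_p>0$, as the bound divides by it) and $0\le\underline c_r\le c_r^t\le\overline c_r$. The decisions are the battery charges $\mathbf b^t\in\mathbb R^N$ (positive when charging, negative when discharging), with limits $\underline{\mathbf b}\le\mathbf 0\le\overline{\mathbf b}$; $\mathbf s^t$ is the vector of states of charge, with initial value $\mathbf s^0\in[\underline{\mathbf s},\overline{\mathbf s}]$. The net demand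 is $\mathbf p^t=\boldsymbol\ell^t+\mathbf b^t$, and the per-unit energy price $c_0^t+c_p^t\sum_{i=1}^Np_i^t$ is assumed positive for all $t$. The matrices are $\mathbf R=2(\mathbf A^\top \mathrm{diag}(\rho)^{-1}\mathbf A)^{-1}$ and $\mathbf X=2(\mathbf A^\top \mathrm{diag}(\chi)^{-1}\mathbf A)^{-1}$, where $\mathbf A$ is the (square, invertible) reduced branch-bus incidence matrix of the radial grid and $\rho,\chi$ are the vectors of line resistances and reactances; $\mathbf R,\mathbf X$ have nonnegative entries. The scalars $\alpha,\beta$ are fixed voltage regulation limits. Constraints, for all $t$: (i) $\mathbf s^{t+1}=\mathbf s^t+\mathbf b^t$ and $\underline{\mathbf s}\le\mathbf s^t\le\overline{\mathbf s}$; (ii) $\underline{\mathbf b}\le\mathbf b^t\le\overline{\mathbf b}$; (iii) $\mathbf p^t=\boldsymbol\ell^t+\mathbf b^t$; (iv) $\alpha\mathbf 1\le-\mathbf R\mathbf p^t-\mathbf X\mathbf q^t\le\beta\mathbf 1$; (v) $r^t=\mathrm{sign}(b_n^t)$ for all $n$, understood as: batteries can only be charged ($b_n^t\ge0$) when $r^t=+1$ and only be discharged ($b_n^t\le0$) when $r^t=-1$, with $b_n^t=0$ allowed in both cases. Game. User $n$'s cost at time $t$ is $f_n^t(\mathbf b^t)=\big(c_0^t+c_p^t\sum_{i=1}^Np_i^t\big)p_n^t-r^tc_r^tb_n^t$, and its time-averaged cost is $F_n(\{\mathbf b^t\})=\lim_{T\to\infty}\frac1T\sum_{t=0}^{T-1}\mathbb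 E[f_n^t(\mathbf b^t)]$. A sequence satisfying (i)–(v) is a generalized Nash equilibrium if no user $n$ can lower $F_n$ by changing only its own sequence $\{b_n^t\}$ while the resulting joint sequence still satisfies (i)–(v). The aggregate cost at time $t$ is $$f^t(\mathbf b^t)=\frac{c_p^t}{2}\Big(\sum_{n=1}^Np_n^t\Big)^2+\sum_{n=1}^N\Big[c_0^tp_n^t+\frac{c_p^t(p_n^t)^2}{2}-r^tc_r^tb_n^t\Big],$$ and $F(\{\mathbf b^t\}):=\lim_{T\to\infty}\frac1T\sum_{t=0}^{T-1}\mathbb E[f^t(\mathbf b^t)]$. Offline aggregate problem: minimize $F(\{\mathbf b^t\})$ over sequences $\{\mathbf b^t\}$ satisfying (i)–(v) for all $t$. Real-time problem: given parameters $\gamma_n$, positive weights $w_n$ and the virtual queues $x_n^t:=s_n^t+\gamma_n$, where $s_n^t=\hat s_n^t$ is the current state of charge under the real-time decisions ($\hat{\mathbf s}^0=\mathbf s^0$, $\hat{\mathbf s}^{t+1}=\hat{\mathbf s}^t+\hat{\mathbf b}^t$), $\hat{\mathbf b}^t$ is the minimizer of $\sum_{n=1}^Nw_nx_n^tb_n^t+f^t(\mathbf b^t)$ over $\mathbf b^t$ subject to (ii)–(v) only. Standing assumptions. (a1) $\overline s_n-\underline s_n>\overline b_n-\underline b_n$ for all $n$. (a2) $\alpha\mathbf 1\le-\mathbf R\boldsymbol\ell^t-\mathbf X\mathbf q^t\le\beta\mathbf 1$ for all $t$. The random variables $\{r^t,c_0^t,c_p^t,c_r^t,\boldsymbol\ell^t,\mathbf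 q^t\}$ are independent and identically distributed over time. The parameters are tuned so that the real-time decisions are feasible for the offline aggregate problem, namely, for all $n$, $w_n\delta_n\ge1$ and $-\frac{\underline g_n}{w_n}+\overline b_n-\overline s_n\le\gamma_n\le-\frac{\overline g_n}{w_n}+\underline b_n-\underline s_n$, where $\underline g_n:=\underline c_0+\frac{\underline c_p}{N}\underline{\boldsymbol\ell}^\top\mathbf 1+\frac{\underline c_p}{N}\underline\ell_n-\overline c_r$, $\overline g_n:=\overline c_0+\frac{\overline c_p}{N}\overline{\boldsymbol\ell}^\top\mathbf 1+\frac{\overline c_p}{N}\overline\ell_n+\overline c_r$, and $\delta_n:=(\overline s_n-\underline s_n+\underline b_n-\overline b_n)/(\overline g_n-\underline g_n)>0$. *)

theory Defs
  imports "HOL-Probability.Probability"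
begin

text \<open>The users are the elements of a finite type \<open>'n\<close>, one per bus of a radial grid whose substation is
  \<^term>\<open>None\<close>. A radial grid has as many lines as non-substation buses, so the lines are indexed
  by \<open>'n\<close> as well; line \<open>e\<close> goes from \<open>line_from e\<close> to \<open>line_to e\<close>. Vectors are ordered entrywise.\<close>

record 'n grid =
  line_from :: "'n \<Rightarrow> 'n option"
  line_to :: "'n \<Rightarrow> 'n option"
  resistance :: "real^'n"
  reactance :: "real^'n"
  v_lo :: real
  v_hi :: real
  load_lo :: "real^'n"
  load_hi :: "real^'n"
  reac_lo :: "real^'n"
  reac_hi :: "real^'n"
  c0_lo :: real
  c0_hi :: real
  cp_lo :: real
  cp_hi :: real
  cr_lo :: real
  cr_hi :: real
  b_lo :: "real^'n"
  b_hi :: "real^'n"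
  s_lo :: "real^'n"
  s_hi :: "real^'n"
  s_init :: "real^'n"

text \<open>The random data of one time period.\<close>

record 'n signal =
  reg :: real
  c0 :: real
  cp :: real
  cr :: real
  load :: "real^'n"
  reac :: "real^'n"

definition signal_tuple ::
    "('n::finite) signal \<Rightarrow> real \<times> real \<times> real \<times> real \<times> (real^'n) \<times> (real^'n)" where
  "signal_tuple \<xi> = (reg \<xi>, c0 \<xi>, cp \<xi>, cr \<xi>, load \<xi>, reac \<xi>)"


subsection \<open>Network\<close>

text \<open>A graph with \<open>N\<close> lines on the \<open>N + 1\<close> buses is a tree iff it is connected.\<close>

definition radial :: "('n::finite) grid \<Rightarrow> bool" where
  "radial G \<longleftrightarrow>
    (\<forall>v. (None, v) \<in> (\<Union>e. {(line_from G e, line_to G e), (line_to G e, line_from G e)})\<^sup>*)"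

text \<open>The branch-bus incidence matrix with the column of the substation removed.\<close>

definition incidence :: "('n::finite) grid \<Rightarrow> real^'n^'n" where
  "incidence G = (\<chi> e i. of_bool (line_from G e = Some i) - of_bool (line_to G e = Some i))"

definition diag :: "real^'n \<Rightarrow> real^'n^('n::finite)" where
  "diag v = (\<chi> i j. if i = j then v $ i else 0)"

definition Rmat :: "('n::finite) grid \<Rightarrow> real^'n^'n" where
  "Rmat G = 2 *\<^sub>R matrix_inv
     (transpose (incidence G) ** matrix_inv (diag (resistance G)) ** incidence G)"

definition Xmat :: "('n::finite) grid \<Rightarrow> real^'n^'n" where
  "Xmat G = 2 *\<^sub>R matrix_inv
     (transpose (incidence G) ** matrix_inv (diag (reactance G)) ** incidence G)"

definition voltage_ok :: "('n::finite) grid \<Rightarrow> real^'n \<Rightarrow> real^'n \<Rightarrow> bool" where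
  "voltage_ok G p q \<longleftrightarrow>
     v_lo G *\<^sub>R 1 \<le> - (Rmat G *v p) - Xmat G *v q \<and>
     - (Rmat G *v p) - Xmat G *v q \<le> v_hi G *\<^sub>R 1"

definition grid_ok :: "('n::finite) grid \<Rightarrow> bool" where
  "grid_ok G \<longleftrightarrow> radial G \<and>
     (\<forall>e. resistance G $ e > 0) \<and> (\<forall>e. reactance G $ e > 0) \<and>
     (\<forall>i j. Rmat G $ i $ j \<ge> 0) \<and> (\<forall>i j. Xmat G $ i $ j \<ge> 0) \<and>
     0 \<le> c0_lo G \<and> 0 < cp_lo G \<and> 0 \<le> cr_lo G \<and>
     b_lo G \<le> 0 \<and> 0 \<le> b_hi G \<and>
     s_lo G \<le> s_init G \<and> s_init G \<le> s_hi G \<and>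
     (\<forall>n. s_hi G $ n - s_lo G $ n > b_hi G $ n - b_lo G $ n)"


subsection \<open>Random data\<close>

definition signal_ok :: "('n::finite) grid \<Rightarrow> 'n signal \<Rightarrow> bool" where
  "signal_ok G \<xi> \<longleftrightarrow> reg \<xi> \<in> {-1, 1} \<and>
     c0 \<xi> \<in> {c0_lo G..c0_hi G} \<and> cp \<xi> \<in> {cp_lo G..cp_hi G} \<and> cr \<xi> \<in> {cr_lo G..cr_hi G} \<and>
     load_lo G \<le> load \<xi> \<and> load \<xi> \<le> load_hi G \<and>
     reac_lo G \<le> reac \<xi> \<and> reac \<xi> \<le> reac_hi G \<and>
     voltage_ok G (load \<xi>) (reac \<xi>)"

text \<open>Independence is across time only: the components of the data of one period may be
  dependent on each other.\<close>

definition iid_signals :: "'w measure \<Rightarrow> ('n::finite) grid \<Rightarrow> (nat \<Rightarrow> 'w \<Rightarrow> 'n signal) \<Rightarrow> bool" where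
  "iid_signals M G \<Xi> \<longleftrightarrow>
     prob_space.indep_vars M (\<lambda>_. borel) (\<lambda>t \<omega>. signal_tuple (\<Xi> t \<omega>)) UNIV \<and>
     (\<forall>t. distr M borel (\<lambda>\<omega>. signal_tuple (\<Xi> t \<omega>)) = distr M borel (\<lambda>\<omega>. signal_tuple (\<Xi> 0 \<omega>))) \<and>
     (AE \<omega> in M. \<forall>t. signal_ok G (\<Xi> t \<omega>))"


subsection \<open>Decisions\<close>

text \<open>The per-period constraints on the battery charges, that is, all constraints except those on
  the state of charge.\<close>

definition admissible :: "('n::finite) grid \<Rightarrow> 'n signal \<Rightarrow> real^'n \<Rightarrow> bool" where
  "admissible G \<xi> b \<longleftrightarrow> b_lo G \<le> b \<and> b \<le> b_hi G \<and>
     voltage_ok G (load \<xi> + b) (reac \<xi>) \<and>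
     (reg \<xi> = 1 \<longrightarrow> 0 \<le> b) \<and> (reg \<xi> = -1 \<longrightarrow> b \<le> 0)"

primrec soc :: "('n::finite) grid \<Rightarrow> (nat \<Rightarrow> real^'n) \<Rightarrow> nat \<Rightarrow> real^'n" where
  "soc G b 0 = s_init G"
| "soc G b (Suc t) = soc G b t + b t"

text \<open>Decision sequences are sequences of random vectors. No causality is imposed, as
  the aggregate problem is an offline one.\<close>

definition feasible ::
    "'w measure \<Rightarrow> ('n::finite) grid \<Rightarrow> (nat \<Rightarrow> 'w \<Rightarrow> 'n signal) \<Rightarrow> (nat \<Rightarrow> 'w \<Rightarrow> real^'n) \<Rightarrow> bool" where
  "feasible M G \<Xi> b \<longleftrightarrow> (\<forall>t. b t \<in> borel_measurable M) \<and>
     (AE \<omega> in M. \<forall>t. s_lo G \<le> soc G (\<lambda>k. b k \<omega>) t \<and> soc G (\<lambda>k. b k \<omega>) t \<le> s_hi G \<and>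
        admissible G (\<Xi> t \<omega>) (b t \<omega>))"

definition price :: "('n::finite) signal \<Rightarrow> real^'n \<Rightarrow> real" where
  "price \<xi> b = c0 \<xi> + cp \<xi> * (\<Sum>i\<in>UNIV. (load \<xi> + b) $ i)"

definition price_positive ::
    "'w measure \<Rightarrow> (nat \<Rightarrow> 'w \<Rightarrow> ('n::finite) signal) \<Rightarrow> (nat \<Rightarrow> 'w \<Rightarrow> real^'n) \<Rightarrow> bool" where
  "price_positive M \<Xi> b \<longleftrightarrow> (AE \<omega> in M. \<forall>t. price (\<Xi> t \<omega>) (b t \<omega>) > 0)"


subsection \<open>Costs\<close>

definition user_cost :: "('n::finite) signal \<Rightarrow> 'n \<Rightarrow> real^'n \<Rightarrow> real" where
  "user_cost \<xi> n b = price \<xi> b * (load \<xi> + b) $ n - reg \<xi> * cr \<xi> * b $ n"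

definition agg_cost :: "('n::finite) signal \<Rightarrow> real^'n \<Rightarrow> real" where
  "agg_cost \<xi> b = cp \<xi> / 2 * (\<Sum>n\<in>UNIV. (load \<xi> + b) $ n)\<^sup>2 +
     (\<Sum>n\<in>UNIV. c0 \<xi> * (load \<xi> + b) $ n + cp \<xi> * ((load \<xi> + b) $ n)\<^sup>2 / 2 - reg \<xi> * cr \<xi> * b $ n)"

definition time_avg :: "(nat \<Rightarrow> real) \<Rightarrow> nat \<Rightarrow> real" where
  "time_avg x T = (\<Sum>t<T. x t) / real T"

text \<open>The limit of the time averages; taking the limit superior makes it defined
  for every sequence. It is the ordinary limit whenever that exists.\<close>

definition long_run_avg :: "(nat \<Rightarrow> real) \<Rightarrow> ereal" where
  "long_run_avg x = limsup (\<lambda>T. ereal (time_avg x T))"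

definition exp_user_cost ::
    "'w measure \<Rightarrow> (nat \<Rightarrow> 'w \<Rightarrow> ('n::finite) signal) \<Rightarrow> 'n \<Rightarrow> (nat \<Rightarrow> 'w \<Rightarrow> real^'n) \<Rightarrow> nat \<Rightarrow> real" where
  "exp_user_cost M \<Xi> n b t = (\<integral>\<omega>. user_cost (\<Xi> t \<omega>) n (b t \<omega>) \<partial>M)"

definition exp_agg_cost ::
    "'w measure \<Rightarrow> (nat \<Rightarrow> 'w \<Rightarrow> ('n::finite) signal) \<Rightarrow> (nat \<Rightarrow> 'w \<Rightarrow> real^'n) \<Rightarrow> nat \<Rightarrow> real" where
  "exp_agg_cost M \<Xi> b t = (\<integral>\<omega>. agg_cost (\<Xi> t \<omega>) (b t \<omega>) \<partial>M)"


subsection \<open>Equilibrium, offline problem, real-time problem\<close>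

definition gen_nash_equilibrium ::
    "'w measure \<Rightarrow> ('n::finite) grid \<Rightarrow> (nat \<Rightarrow> 'w \<Rightarrow> 'n signal) \<Rightarrow> (nat \<Rightarrow> 'w \<Rightarrow> real^'n) \<Rightarrow> bool" where
  "gen_nash_equilibrium M G \<Xi> b \<longleftrightarrow> feasible M G \<Xi> b \<and>
     (\<forall>n b'. feasible M G \<Xi> b' \<and> (AE \<omega> in M. \<forall>t m. m \<noteq> n \<longrightarrow> b' t \<omega> $ m = b t \<omega> $ m) \<longrightarrow>
        long_run_avg (exp_user_cost M \<Xi> n b) \<le> long_run_avg (exp_user_cost M \<Xi> n b'))"

text \<open>The objective is a genuine limit: a minimizer is only compared with the feasible
  sequences for which the limit exists.\<close>

definition offline_minimizer ::
    "'w measure \<Rightarrow> ('n::finite) grid \<Rightarrow> (nat \<Rightarrow> 'w \<Rightarrow> 'n signal) \<Rightarrow> (nat \<Rightarrow> 'w \<Rightarrow> real^'n) \<Rightarrow> bool" where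
  "offline_minimizer M G \<Xi> b \<longleftrightarrow>
     is_arg_min (\<lambda>b. lim (time_avg (exp_agg_cost M \<Xi> b)))
       (\<lambda>b. feasible M G \<Xi> b \<and> convergent (time_avg (exp_agg_cost M \<Xi> b))) b"

definition real_time_decisions ::
    "'w measure \<Rightarrow> ('n::finite) grid \<Rightarrow> (nat \<Rightarrow> 'w \<Rightarrow> 'n signal) \<Rightarrow> real^'n \<Rightarrow> real^'n \<Rightarrow>
     (nat \<Rightarrow> 'w \<Rightarrow> real^'n) \<Rightarrow> bool" where
  "real_time_decisions M G \<Xi> w \<gamma> b \<longleftrightarrow> (\<forall>t. b t \<in> borel_measurable M) \<and>
     (AE \<omega> in M. \<forall>t.
        is_arg_min
          (\<lambda>y. (\<Sum>n\<in>UNIV. w $ n * (soc G (\<lambda>k. b k \<omega>) t $ n + \<gamma> $ n) * y $ n) + agg_cost (\<Xi> t \<omega>) y)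
          (admissible G (\<Xi> t \<omega>)) (b t \<omega>))"


subsection \<open>Tuning of the parameters\<close>

definition g_lo :: "('n::finite) grid \<Rightarrow> 'n \<Rightarrow> real" where
  "g_lo G n = c0_lo G + cp_lo G / real CARD('n) * (\<Sum>i\<in>UNIV. load_lo G $ i) +
     cp_lo G / real CARD('n) * load_lo G $ n - cr_hi G"

definition g_hi :: "('n::finite) grid \<Rightarrow> 'n \<Rightarrow> real" where
  "g_hi G n = c0_hi G + cp_hi G / real CARD('n) * (\<Sum>i\<in>UNIV. load_hi G $ i) +
     cp_hi G / real CARD('n) * load_hi G $ n + cr_hi G"

definition delta :: "('n::finite) grid \<Rightarrow> 'n \<Rightarrow> real" where
  "delta G n = (s_hi G $ n - s_lo G $ n + b_lo G $ n - b_hi G $ n) / (g_hi G n - g_lo G n)"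

definition tuned :: "('n::finite) grid \<Rightarrow> real^'n \<Rightarrow> real^'n \<Rightarrow> bool" where
  "tuned G w \<gamma> \<longleftrightarrow> (\<forall>n. w $ n > 0 \<and> delta G n > 0 \<and> w $ n * delta G n \<ge> 1 \<and>
     - g_lo G n / w $ n + b_hi G $ n - s_hi G $ n \<le> \<gamma> $ n \<and>
     \<gamma> $ n \<le> - g_hi G n / w $ n + b_lo G $ n - s_lo G $ n)"

definition K_const :: "('n::finite) grid \<Rightarrow> real^'n \<Rightarrow> real" where
  "K_const G w = 1 / 2 * (\<Sum>n\<in>UNIV. w $ n * max ((b_hi G $ n)\<^sup>2) ((b_lo G $ n)\<^sup>2))"

end

theory Submission
  imports Defs
begin

text \<open>Let \<open>V\<close> be the offline value. The heart of the matter is that no feasible sequence can have an average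
  cost below \<open>V\<close> even along a subsequence of horizons, although the offline problem only admits
  sequences whose average cost converges. If a feasible sequence did better on the first \<open>T\<close> periods
  for some large \<open>T\<close>, one could play, on every block of \<open>T\<close> periods, the cheapest admissible charges
  from the current state of charge. As the data are i.i.d., and as any reference trajectory
  can be tracked from any other state at a cost bounded independently of \<open>T\<close>, every block would be
  nearly as cheap as the first one; scaling the charges down adjusts all blocks to the same cost, and a
  convergent average below \<open>V\<close> results.

  The aggregate cost is an exact potential of the game, so this bound makes an offline minimizer an
  equilibrium. Applied to convex combinations of the offline and the real-time decisions, it bounds
  \<open>c\<^sub>p / 2\<close> times the average squared distance by the excess of the real-time cost over \<open>V\<close>. That excess is at
  most \<open>K\<close>: the virtual queues depend on past data only and act as Lagrange multipliers of the
  constraint that charges average to zero, so weak duality bounds the drift-plus-penalty of each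
  period by \<open>V\<close>, and the drift telescopes.\<close>

subsection \<open>Measurable selection of minimizers\<close>

text \<open>Decisions have to be random variables, so the cheapest block must be selected measurably
  in the state of charge and the data. The positive lower bound on \<open>cp\<close> makes the costs
  strictly convex; minimizers are then unique, and unique minimizers over a compact set are Borel
  functions of the parameters. Uniqueness serves a second time for the real-time decisions: these
  are only known to minimize along each path, and it identifies them with one fixed function of the
  queue and the current data, which exposes the queue as a function of the past.

  The lower bound on feasible averages is proved for eventually all horizons instead of for limits,
  because neither a unilateral deviation nor a mixture of offline and real-time decisions need have
  a convergent average cost.\<close>

lemma compact_projection_closed:
  fixes F :: "('a::metric_space \<times> 'b::metric_space) set"
  assumes "closed F" and "compact K"
  shows "closed {a. \<exists>b\<in>K. (a, b) \<in> F}"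
  unfolding closed_sequential_limits
proof (intro allI impI)
  fix x l
  assume *: "(\<forall>n. x n \<in> {a. \<exists>b\<in>K. (a, b) \<in> F}) \<and> x \<longlonglongrightarrow> l"
  then have "\<forall>n. \<exists>b. b \<in> K \<and> (x n, b) \<in> F"
    by blast
  then obtain y where y: "\<And>n. y n \<in> K" "\<And>n. (x n, y n) \<in> F"
    by metis
  obtain k r where k: "k \<in> K" "strict_mono r" "(y \<circ> r) \<longlonglongrightarrow> k"
    using \<open>compact K\<close> y(1) unfolding compact_def by blast
  have "(x \<circ> r) \<longlonglongrightarrow> l"
    using * k by (intro LIMSEQ_subseq_LIMSEQ) auto
  then have "(\<lambda>n. ((x \<circ> r) n, (y \<circ> r) n)) \<longlonglongrightarrow> (l, k)"
    using k by (intro tendsto_Pair)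
  then have "(l, k) \<in> F"
    by (rule closed_sequentially[OF \<open>closed F\<close>, rotated]) (simp add: y)
  then show "l \<in> {a. \<exists>b\<in>K. (a, b) \<in> F}"
    using k by blast
qed

text \<open>By \<open>conv\<close> the worse of two distinct feasible points is never optimal, so
  minimizers are unique. Then \<open>h a\<close> lies in a closed set \<open>C\<close> iff the
  minimum over \<open>C\<close> equals the minimum over the whole fibre, a statement about optimal
  values only, which is Borel in \<open>a\<close>. The last clause of the conclusion lets any other
  minimizer be recognized as \<open>h a\<close>.\<close>

lemma measurable_argmin:
  fixes F :: "('a::metric_space \<times> 'b::metric_space) set" and c :: "'a \<Rightarrow> 'b \<Rightarrow> real"
  assumes F: "closed F" and K: "compact K" and FK: "F \<subseteq> UNIV \<times> K"
    and c: "continuous_on F (\<lambda>p. c (fst p) (snd p))"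
    and conv: "\<And>a b b'. (a, b) \<in> F \<Longrightarrow> (a, b') \<in> F \<Longrightarrow> b \<noteq> b' \<Longrightarrow>
      \<exists>m. (a, m) \<in> F \<and> c a m < max (c a b) (c a b')"
  shows "\<exists>h. h \<in> borel_measurable borel \<and> (\<forall>a b. (a, b) \<in> F \<longrightarrow>
    (a, h a) \<in> F \<and> c a (h a) \<le> c a b \<and> (c a b \<le> c a (h a) \<longrightarrow> b = h a))"
proof -
  have attain: "\<exists>b\<in>C. (a, b) \<in> F \<and> (\<forall>b'\<in>C. (a, b') \<in> F \<longrightarrow> c a b \<le> c a b')"
    if C: "closed C" and ne: "b0 \<in> C" "(a, b0) \<in> F" for a b0 C
  proof -
    let ?S = "K \<inter> (C \<inter> Pair a -` F)"
    have "closed (Pair a -` F)"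
      by (intro continuous_closed_vimage F) (auto intro!: continuous_intros)
    then have "compact ?S"
      using C K by (intro compact_Int_closed closed_Int) auto
    moreover have "?S \<noteq> {}"
      using ne FK by blast
    moreover have "continuous_on ?S (\<lambda>b. c a b)"
    proof -
      have "continuous_on ?S (Pair a)" and "Pair a ` ?S \<subseteq> F"
        by (auto intro!: continuous_intros)
      from continuous_on_compose2[OF c this] show ?thesis by simp
    qed
    ultimately obtain b where "b \<in> ?S" "\<forall>b'\<in>?S. c a b \<le> c a b'"
      using continuous_attains_inf by metis
    then show ?thesis
      using FK by blast
  qed
  define b0 :: 'b where "b0 = undefined"
  define h where "h a = (if \<exists>b. (a, b) \<in> F
    then SOME b. (a, b) \<in> F \<and> (\<forall>b'. (a, b') \<in> F \<longrightarrow> c a b \<le> c a b') else b0)" for a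
  have h: "(a, h a) \<in> F \<and> (\<forall>b'. (a, b') \<in> F \<longrightarrow> c a (h a) \<le> c a b')"
    if "(a, b) \<in> F" for a b
  proof -
    have "\<exists>b. (a, b) \<in> F \<and> (\<forall>b'. (a, b') \<in> F \<longrightarrow> c a b \<le> c a b')"
      using attain[of UNIV b a] that by auto
    from someI_ex[OF this] show ?thesis
      unfolding h_def using that by auto
  qed
  have uniq: "b = h a" if "(a, b) \<in> F" "c a b \<le> c a (h a)" for a b
    using conv[of a b "h a"] h[of a b] that by fastforce
  define D where "D = {a. \<exists>b. (a, b) \<in> F}"
  have D_eq: "D = {a. \<exists>b\<in>K. (a, b) \<in> F}"
    using FK unfolding D_def by blast
  have D: "D \<in> sets borel"
    unfolding D_eq using compact_projection_closed[OF F K] by auto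
  \<comment> \<open>A projection of a Borel set need not be Borel; projecting a closed set along the
    compact \<open>K\<close> leaves it closed.\<close>
  have sub: "{a. \<exists>b\<in>K. (a, b) \<in> F \<inter> {p. snd p \<in> C \<and> c (fst p) (snd p) \<le> q}} \<in> sets borel"
    if "closed C" for C and q :: real
  proof -
    have "F \<inter> {p. snd p \<in> C \<and> c (fst p) (snd p) \<le> q}
        = (snd -` C) \<inter> (F \<inter> (\<lambda>p. c (fst p) (snd p)) -` {..q})"
      by auto
    moreover have "closed (F \<inter> (\<lambda>p. c (fst p) (snd p)) -` {..q})"
      using c continuous_on_closed_vimage[OF F] by (metis Int_commute closed_atMost)
    moreover have "closed (snd -` C :: ('a \<times> 'b) set)"
      using that by (intro continuous_closed_vimage) (auto intro!: continuous_intros)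
    ultimately have "closed (F \<inter> {p. snd p \<in> C \<and> c (fst p) (snd p) \<le> q})"
      by auto
    from compact_projection_closed[OF this K] show ?thesis by auto
  qed
  have closed_vimage: "h -` C \<in> sets borel" if C: "closed C" for C
  proof -
    let ?A = "\<lambda>C (q::real). {a. \<exists>b\<in>K. (a, b) \<in> F \<inter> {p. snd p \<in> C \<and> c (fst p) (snd p) \<le> q}}"
    \<comment> \<open>Equality of the two minima is tested level by level: each level reached in the
      fibre must be reached within \<open>C\<close>. Rational levels suffice and keep the
      intersection countable. Outside \<open>D\<close> the fibre is empty and \<open>h\<close> takes
      the default \<open>b0\<close>.\<close>
    have eq: "h -` C = (D \<inter> (\<Inter>q\<in>\<rat>. (- ?A UNIV q) \<union> ?A C q)) \<union> (if b0 \<in> C then - D else {})"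
      (is "_ = ?R")
    proof (intro set_eqI iffI)
      fix a assume a: "a \<in> h -` C"
      show "a \<in> ?R"
      proof (cases "a \<in> D")
        case True
        then obtain b where b: "(a, b) \<in> F" by (auto simp: D_def)
        have "a \<in> ?A C q" if "a \<in> ?A UNIV q" for q
          using that h a FK by fastforce
        then show ?thesis using True by blast
      next
        case False
        then show ?thesis using a by (auto simp: D_def h_def)
      qed
    next
      fix a assume a: "a \<in> ?R"
      show "a \<in> h -` C"
      proof (cases "a \<in> D")
        case True
        then obtain b where b: "(a, b) \<in> F" by (auto simp: D_def)
        note ha = h[OF b]
        have q: "\<exists>b\<in>C. (a, b) \<in> F \<and> c a b \<le> q" if "q \<in> \<rat>" "c a (h a) \<le> q" for q
        proof -
          have "a \<in> ?A UNIV q" using ha that FK by auto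
          then have "a \<in> ?A C q" using a True \<open>q \<in> \<rat>\<close> by (auto split: if_splits)
          then show ?thesis by auto
        qed
        \<comment> \<open>One level above the minimum shows that \<open>C\<close> meets the fibre at
          all, which \<open>attain\<close> requires.\<close>
        obtain q0 where q0: "q0 \<in> \<rat>" "c a (h a) < q0"
          using Rats_dense_in_real[of "c a (h a)" "c a (h a) + 1"] by auto
        then obtain b1 where b1: "b1 \<in> C" "(a, b1) \<in> F"
          using q[of q0] by auto
        obtain m where m: "m \<in> C" "(a, m) \<in> F" "\<forall>b'\<in>C. (a, b') \<in> F \<longrightarrow> c a m \<le> c a b'"
          using attain[OF C b1] by auto
        have "c a m \<le> c a (h a)"
        proof (rule ccontr)
          assume "\<not> ?thesis"
          then obtain r where "r \<in> \<rat>" "c a (h a) < r" "r < c a m"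
            using Rats_dense_in_real[of "c a (h a)" "c a m"] by auto
          then show False using q[of r] m(3) by force
        qed
        then have "m = h a" using uniq m by auto
        then show ?thesis using m by auto
      next
        case False
        then show ?thesis using a by (auto simp: D_def h_def split: if_splits)
      qed
    qed
    have "(\<Inter>q\<in>\<rat>. (- ?A UNIV q) \<union> ?A C q) \<in> sets borel"
      using sub[of UNIV] sub[OF C] countable_rat
      by (intro sets.countable_INT'') (auto simp del: Int_iff intro!: sets.Un)
    then show ?thesis
      unfolding eq using D by auto
  qed
  have "h \<in> borel_measurable borel"
  proof (rule borel_measurableI)
    fix S :: "'b set" assume "open S"
    then have "- (h -` (- S)) \<in> sets borel"
      using closed_vimage[of "- S"] by (auto intro: borel_comp)
    then show "h -` S \<inter> space borel \<in> sets borel"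
      by (simp add: vimage_Compl)
  qed
  then show ?thesis
    using h uniq by (intro exI[of _ h]) blast
qed

section \<open>Topology of the data and of the constraints\<close>

type_synonym 'n data = "real \<times> real \<times> real \<times> real \<times> (real^'n) \<times> (real^'n)"

text \<open>Continuity, compactness and measurability are established on tuples with their product
  topology; \<open>sig_of\<close> transports them to the records in which costs and constraints are
  phrased.\<close>

definition sig_of :: "('n::finite) data \<Rightarrow> 'n signal" where
  "sig_of x = \<lparr>reg = fst x, c0 = fst (snd x), cp = fst (snd (snd x)), cr = fst (snd (snd (snd x))),
     load = fst (snd (snd (snd (snd x)))), reac = snd (snd (snd (snd (snd x))))\<rparr>"

lemma sig_of_signal_tuple [simp]: "sig_of (signal_tuple \<xi>) = \<xi>"
  by (simp add: sig_of_def signal_tuple_def)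

lemma continuous_on_agg_cost [continuous_intros]:
  assumes f: "continuous_on S f" and g: "continuous_on S g"
  shows "continuous_on S (\<lambda>x. agg_cost (sig_of (f x)) (g x))"
  unfolding agg_cost_def sig_of_def by (auto intro!: continuous_intros f g)

lemma continuous_on_user_cost [continuous_intros]:
  assumes f: "continuous_on S f" and g: "continuous_on S g"
  shows "continuous_on S (\<lambda>x. user_cost (sig_of (f x)) n (g x))"
  unfolding user_cost_def price_def sig_of_def by (auto intro!: continuous_intros f g)

lemma closed_Collect_vec_le:
  fixes f g :: "'a::topological_space \<Rightarrow> real^'n::finite"
  assumes "continuous_on UNIV f" and "continuous_on UNIV g"
  shows "closed {x. f x \<le> g x}"
  unfolding less_eq_vec_def
  by (intro closed_Collect_all closed_Collect_le continuous_intros assms)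

lemma continuous_on_matrix_vector_mult [continuous_intros]:
  fixes A :: "real^'n::finite^'m::finite"
  assumes "continuous_on S f"
  shows "continuous_on S (\<lambda>x. A *v f x)"
  by (rule continuous_on_compose2[OF matrix_vector_mult_linear_continuous_on[of UNIV A] assms]) auto

lemma closed_Collect_voltage_ok:
  assumes "continuous_on UNIV f" and "continuous_on UNIV g"
  shows "closed {x. voltage_ok G (f x) (g x)}"
  unfolding voltage_ok_def
  by (intro closed_Collect_conj closed_Collect_vec_le continuous_intros assms)

text \<open>The known bounds on prices and loads enter here: continuous functions of data and
  charges become uniformly bounded, which yields all later constants and integrability.\<close>

lemma compact_signals:
  fixes G :: "('n::finite) grid"
  shows "compact {x. signal_ok G (sig_of x)}"
proof -
  have mem: "closed {x. f x \<in> {a..b}}" if "continuous_on UNIV f"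
    for f :: "'n data \<Rightarrow> real" and a b
    using that by (auto intro!: closed_Collect_conj closed_Collect_le continuous_intros)
  have fin: "closed {x. f x \<in> {-1, 1}}" if "continuous_on UNIV f"
    for f :: "'n data \<Rightarrow> real"
    using that by (auto intro!: closed_Collect_disj closed_Collect_eq continuous_intros)
  have "closed {x. signal_ok G (sig_of x)}"
    unfolding signal_ok_def
    by (intro closed_Collect_conj closed_Collect_vec_le closed_Collect_voltage_ok mem fin)
      (simp_all add: sig_of_def, (intro continuous_intros)+)
  moreover have "compact ({-1..1::real} \<times> {c0_lo G..c0_hi G} \<times> {cp_lo G..cp_hi G} \<times> {cr_lo G..cr_hi G} \<times>
      cbox (load_lo G) (load_hi G) \<times> cbox (reac_lo G) (reac_hi G))"
    by (intro compact_Times compact_Icc compact_cbox)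
  moreover have "{x. signal_ok G (sig_of x)} \<subseteq> {-1..1} \<times> {c0_lo G..c0_hi G} \<times> {cp_lo G..cp_hi G} \<times>
      {cr_lo G..cr_hi G} \<times> cbox (load_lo G) (load_hi G) \<times> cbox (reac_lo G) (reac_hi G)"
    by (auto simp: signal_ok_def sig_of_def interval_cbox_cart[symmetric])
  ultimately show ?thesis
    by (metis compact_Int_closed inf.absorb_iff2)
qed

lemma closed_admissible:
  assumes f: "continuous_on UNIV f" and g: "continuous_on UNIV g"
  shows "closed {x. signal_ok G (sig_of (f x)) \<and> admissible G (sig_of (f x)) (g x)}"
proof -
  \<comment> \<open>The sign conditions are implications from equations and do not look closed. As
    \<open>reg \<xi>\<close> is 1 or -1, they merge into the single closed condition
    \<open>0 \<le> reg \<xi> *\<^sub>R b\<close>.\<close>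
  have eq: "signal_ok G \<xi> \<and> admissible G \<xi> b \<longleftrightarrow>
      signal_ok G \<xi> \<and> b_lo G \<le> b \<and> b \<le> b_hi G \<and> voltage_ok G (load \<xi> + b) (reac \<xi>) \<and> 0 \<le> reg \<xi> *\<^sub>R b"
    for \<xi> b
    by (auto simp: signal_ok_def admissible_def less_eq_vec_def)
  have "closed (f -` {x. signal_ok G (sig_of x)})"
    by (rule closed_vimage[OF compact_imp_closed[OF compact_signals] f])
  then have "closed {x. signal_ok G (sig_of (f x))}"
    by (simp add: vimage_def)
  then show ?thesis
    unfolding eq
    by (intro closed_Collect_conj closed_Collect_vec_le closed_Collect_voltage_ok)
      (auto simp: sig_of_def intro!: continuous_intros f g)
qed

subsection \<open>Convexity, shrinking and tracking\<close>

lemma norm_vec_power2: "(norm (x :: real^'n::finite))\<^sup>2 = (\<Sum>n\<in>UNIV. (x $ n)\<^sup>2)"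
  unfolding power2_norm_eq_inner by (simp add: inner_vec_def power2_eq_square)

text \<open>The quadratic part of \<open>agg_cost\<close>, equivalently half its second derivative
  in direction \<open>d\<close>.\<close>

definition cost_gap :: "('n::finite) signal \<Rightarrow> real^'n \<Rightarrow> real" where
  "cost_gap \<xi> d = cp \<xi> / 2 * ((\<Sum>n\<in>UNIV. d $ n)\<^sup>2 + (norm d)\<^sup>2)"

text \<open>For a quadratic function the convexity defect is known exactly. The equality serves
  three ends: strict convexity, strong convexity, and the polynomial dependence of the cost on a
  scaling factor.\<close>

lemma agg_cost_convex_combination:
  "agg_cost \<xi> ((1 - u) *\<^sub>R a + u *\<^sub>R b) =
    (1 - u) * agg_cost \<xi> a + u * agg_cost \<xi> b - u * (1 - u) * cost_gap \<xi> (b - a)"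
proof -
  let ?p = "\<lambda>c n. (load \<xi> + c) $ n"
  let ?S = "\<lambda>c. \<Sum>n\<in>UNIV. ?p c n"
  let ?m = "(1 - u) *\<^sub>R a + u *\<^sub>R b"
  let ?t = "\<lambda>c n. c0 \<xi> * ?p c n + cp \<xi> * (?p c n)\<^sup>2 / 2 - reg \<xi> * cr \<xi> * c $ n"
  have p: "?p ?m n = (1 - u) * ?p a n + u * ?p b n" for n
    by (simp add: algebra_simps)
  have S: "?S ?m = (1 - u) * ?S a + u * ?S b"
    unfolding p by (simp only: sum.distrib sum_distrib_left)
  have d: "(\<Sum>n\<in>UNIV. (b - a) $ n) = ?S b - ?S a"
    by (simp add: sum.distrib sum_subtractf)
  have pt: "?t ?m n = (1 - u) * ?t a n + u * ?t b n - u * (1 - u) * (cp \<xi> / 2) * ((b - a) $ n)\<^sup>2" for n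
    by (simp add: field_simps power2_eq_square)
  have terms: "(\<Sum>n\<in>UNIV. ?t ?m n) =
      (1 - u) * (\<Sum>n\<in>UNIV. ?t a n) + u * (\<Sum>n\<in>UNIV. ?t b n) - u * (1 - u) * (cp \<xi> / 2) * (norm (b - a))\<^sup>2"
  proof -
    have "(\<Sum>n\<in>UNIV. (1 - u) * f n + u * g n - k * h n) =
        (1 - u) * sum f UNIV + u * sum g UNIV - k * sum h UNIV" for f g h :: "'a \<Rightarrow> real" and k
      by (simp only: sum.distrib sum_subtractf sum_distrib_left)
    from this[of "?t a" "?t b"] show ?thesis
      unfolding pt norm_vec_power2 .
  qed
  have "cp \<xi> / 2 * (?S ?m)\<^sup>2 =
      (1 - u) * (cp \<xi> / 2 * (?S a)\<^sup>2) + u * (cp \<xi> / 2 * (?S b)\<^sup>2)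
      - u * (1 - u) * (cp \<xi> / 2) * (?S b - ?S a)\<^sup>2"
    unfolding S by (simp add: field_simps power2_eq_square)
  then show ?thesis
    unfolding agg_cost_def terms cost_gap_def d by (simp add: algebra_simps)
qed

lemma cost_gap_ge:
  assumes "c \<le> cp \<xi>" and "0 \<le> c"
  shows "c / 2 * (norm d)\<^sup>2 \<le> cost_gap \<xi> d"
proof -
  have "c / 2 * (norm d)\<^sup>2 \<le> cp \<xi> / 2 * (norm d)\<^sup>2"
    using assms by (intro mult_right_mono) auto
  also have "\<dots> \<le> cost_gap \<xi> d"
    unfolding cost_gap_def using assms by (intro mult_left_mono) auto
  finally show ?thesis .
qed

text \<open>Up to the factor \<open>cp \<xi>\<close>, half the square of the total demand
  contributes to user \<open>n\<close> half the square of its own demand plus its demand times that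
  of the others. The separate square supplies the missing half, so that own demand times total
  demand appears, as in the user's cost.\<close>

lemma user_cost_diff_eq_agg_cost_diff:
  assumes "\<And>m. m \<noteq> n \<Longrightarrow> b' $ m = b $ m"
  shows "user_cost \<xi> n b' - user_cost \<xi> n b = agg_cost \<xi> b' - agg_cost \<xi> b"
proof -
  let ?p = "\<lambda>c n. (load \<xi> + c) $ n"
  let ?t = "\<lambda>c n. c0 \<xi> * ?p c n + cp \<xi> * (?p c n)\<^sup>2 / 2 - reg \<xi> * cr \<xi> * c $ n"
  have split: "(\<Sum>m\<in>UNIV. g m) = g n + (\<Sum>m\<in>UNIV-{n}. g m)" for g :: "_ \<Rightarrow> real"
    by (simp add: sum.remove)
  have rest: "(\<Sum>m\<in>UNIV-{n}. ?p b' m) = (\<Sum>m\<in>UNIV-{n}. ?p b m)"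
    "(\<Sum>m\<in>UNIV-{n}. ?t b' m) = (\<Sum>m\<in>UNIV-{n}. ?t b m)"
    using assms by (auto intro!: sum.cong)
  show ?thesis
    unfolding user_cost_def price_def agg_cost_def split[of "?p b'"] split[of "?p b"]
      split[of "?t b'"] split[of "?t b"] rest
    by (simp add: field_simps power2_eq_square)
qed

text \<open>\<open>z\<close> omits exactly those parts of the increments of \<open>S\<close> that close the gap between the two, so
  the increments omitted altogether amount to at most the initial gap.\<close>

lemma scalar_tracking:
  fixes S :: "nat \<Rightarrow> real"
  assumes S: "\<And>i. S i \<in> {lo..hi}" and a: "a \<in> {lo..hi}"
  shows "\<exists>z. z 0 = a \<and> (\<forall>i. z i \<in> {lo..hi}) \<and>
    (\<forall>i. z (Suc i) - z i \<in> closed_segment 0 (S (Suc i) - S i)) \<and>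
    (\<forall>T. (\<Sum>i<T. \<bar>(S (Suc i) - S i) - (z (Suc i) - z i)\<bar>) \<le> hi - lo)"
proof -
  \<comment> \<open>\<open>e\<close> is the lead of \<open>S\<close> over \<open>z\<close> and
    \<open>\<beta>\<close> the next increment of \<open>S\<close>. An increment that would widen the
    gap is copied; one that narrows it is absorbed up to the part that overshoots.\<close>
  define sh where "sh e \<beta> = (if 0 \<le> \<beta> then (if 0 \<le> e then \<beta> else max 0 (e + \<beta>))
      else (if e \<le> 0 then \<beta> else min 0 (e + \<beta>)))" for e \<beta> :: real
  define z where "z = rec_nat a (\<lambda>i y. y + sh (S i - y) (S (Suc i) - S i))"
  have z0: "z 0 = a" and zS: "z (Suc i) = z i + sh (S i - z i) (S (Suc i) - S i)" for i
    by (simp_all add: z_def)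
  \<comment> \<open>Copying keeps \<open>z\<close> on the same side of \<open>S\<close>, absorbing
    leaves it in place, and after an overshoot it coincides with \<open>S\<close>; so it never
    leaves the interval containing \<open>S\<close>.\<close>
  have rng: "z i \<in> {lo..hi}" for i
  proof (induction i)
    case 0
    then show ?case using a z0 by simp
  next
    case (Suc i)
    then show ?case
      using S[of i] S[of "Suc i"] unfolding zS sh_def by (auto simp: max_def min_def)
  qed
  have seg: "z (Suc i) - z i \<in> closed_segment 0 (S (Suc i) - S i)" for i
    unfolding zS sh_def closed_segment_eq_real_ivl by (auto simp: max_def min_def)
  have step: "\<bar>S (Suc i) - z (Suc i)\<bar> + \<bar>(S (Suc i) - S i) - (z (Suc i) - z i)\<bar> = \<bar>S i - z i\<bar>" for i
    unfolding zS sh_def by (auto simp: max_def min_def abs_if)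
  have "\<bar>S T - z T\<bar> + (\<Sum>i<T. \<bar>(S (Suc i) - S i) - (z (Suc i) - z i)\<bar>) = \<bar>S 0 - z 0\<bar>" for T
  proof (induction T)
    case (Suc T)
    then show ?case using step[of T] by simp
  qed simp
  then have "(\<Sum>i<T. \<bar>(S (Suc i) - S i) - (z (Suc i) - z i)\<bar>) \<le> hi - lo" for T
    using S[of 0] a z0 by (smt (verit) atLeastAtMost_iff)
  then show ?thesis
    using z0 rng seg by blast
qed

text \<open>The coordinates are tracked independently. This is legitimate because the coupling
  constraint, the voltage limits, tolerates shrinking single coordinates; the
  \<open>closed_segment\<close> conclusion is the form in which \<open>admissible_shrink\<close>
  needs it.\<close>

lemma vector_tracking:
  fixes b :: "nat \<Rightarrow> real^'n::finite"
  assumes ref: "\<And>i. lo \<le> s0 + (\<Sum>k<i. b k) \<and> s0 + (\<Sum>k<i. b k) \<le> hi"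
    and s: "lo \<le> s" "s \<le> hi"
  obtains b' where "\<And>i. lo \<le> s + (\<Sum>k<i. b' k) \<and> s + (\<Sum>k<i. b' k) \<le> hi"
    and "\<And>i n. b' i $ n \<in> closed_segment 0 (b i $ n)"
    and "\<And>T n. (\<Sum>i<T. \<bar>b i $ n - b' i $ n\<bar>) \<le> hi $ n - lo $ n"
proof -
  let ?S = "\<lambda>n i. (s0 + (\<Sum>k<i. b k)) $ n"
  define P where "P n z \<longleftrightarrow> z 0 = s $ n \<and> (\<forall>i. z i \<in> {lo $ n..hi $ n}) \<and>
      (\<forall>i. z (Suc i) - z i \<in> closed_segment 0 (b i $ n)) \<and>
      (\<forall>T. (\<Sum>i<T. \<bar>b i $ n - (z (Suc i) - z i)\<bar>) \<le> hi $ n - lo $ n)" for n z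
  have "\<exists>z. P n z" for n
  proof -
    have d: "?S n (Suc i) - ?S n i = b i $ n" for i by simp
    have "\<And>i. ?S n i \<in> {lo $ n..hi $ n}" "s $ n \<in> {lo $ n..hi $ n}"
      using ref s by (auto simp: less_eq_vec_def)
    from scalar_tracking[where S = "?S n", OF this, unfolded d] show ?thesis
      unfolding P_def .
  qed
  then obtain z where "\<And>n. P n (z n)"
    by metis
  then have z: "\<And>n. z n 0 = s $ n" "\<And>n i. z n i \<in> {lo $ n..hi $ n}"
      "\<And>n i. z n (Suc i) - z n i \<in> closed_segment 0 (b i $ n)"
      "\<And>n T. (\<Sum>i<T. \<bar>b i $ n - (z n (Suc i) - z n i)\<bar>) \<le> hi $ n - lo $ n"
    unfolding P_def by blast+
  define b' :: "nat \<Rightarrow> real^'n" where "b' i = (\<chi> n. z n (Suc i) - z n i)" for i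
  have sums: "s + (\<Sum>k<i. b' k) = (\<chi> n. z n i)" for i
    by (simp add: vec_eq_iff b'_def z(1) sum_lessThan_telescope)
  show ?thesis
  proof (rule that)
    show "lo \<le> s + (\<Sum>k<i. b' k) \<and> s + (\<Sum>k<i. b' k) \<le> hi" for i
      unfolding sums using z(2)[of _ i] by (simp add: less_eq_vec_def)
    show "b' i $ n \<in> closed_segment 0 (b i $ n)" for i n
      using z(3)[of n i] by (simp add: b'_def)
    show "(\<Sum>i<T. \<bar>b i $ n - b' i $ n\<bar>) \<le> hi $ n - lo $ n" for T n
      using z(4)[of n T] by (simp add: b'_def)
  qed
qed

lemma soc_eq_sum: "soc G b t = s_init G + (\<Sum>k<t. b k)"
  by (induction t) (auto simp: algebra_simps)

lemma convex_combination_mono: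
  fixes a b c d :: "real^'n::finite"
  assumes "a \<le> c" and "b \<le> d" and "0 \<le> u" and "u \<le> 1"
  shows "(1 - u) *\<^sub>R a + u *\<^sub>R b \<le> (1 - u) *\<^sub>R c + u *\<^sub>R d"
  using assms by (auto simp: less_eq_vec_def intro!: add_mono mult_left_mono)

lemma convex_combination_same: "(1 - u) *\<^sub>R a + u *\<^sub>R a = (a :: real^'n::finite)"
  by (simp add: algebra_simps)

lemma admissible_convex:
  assumes a: "admissible G \<xi> a" and b: "admissible G \<xi> b" and u: "0 \<le> u" "u \<le> 1"
  shows "admissible G \<xi> ((1 - u) *\<^sub>R a + u *\<^sub>R b)" (is "admissible G \<xi> ?m")
proof -
  have mono: "x \<le> ?m" if "x \<le> a" "x \<le> b" for x
    using convex_combination_mono[OF that u] by (simp add: convex_combination_same)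
  have mono': "?m \<le> x" if "a \<le> x" "b \<le> x" for x
    using convex_combination_mono[OF that u] by (simp add: convex_combination_same)
  let ?V = "\<lambda>c. - (Rmat G *v (load \<xi> + c)) - Xmat G *v reac \<xi>"
  have load: "load \<xi> + ?m = (1 - u) *\<^sub>R (load \<xi> + a) + u *\<^sub>R (load \<xi> + b)"
    by (simp add: algebra_simps)
  have V: "?V ?m = (1 - u) *\<^sub>R ?V a + u *\<^sub>R ?V b"
    unfolding load matrix_vector_right_distrib[of _ "(1 - u) *\<^sub>R _"] matrix_vector_mult_scaleR
    by (simp add: scaleR_diff_right scaleR_diff_left)
  have "x \<le> ?V ?m" if "x \<le> ?V a" "x \<le> ?V b" for x
    using convex_combination_mono[OF that u] unfolding V by (simp only: convex_combination_same)
  moreover have "?V ?m \<le> x" if "?V a \<le> x" "?V b \<le> x" for x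
    using convex_combination_mono[OF that u] unfolding V by (simp only: convex_combination_same)
  ultimately show ?thesis
    using a b mono mono' unfolding admissible_def voltage_ok_def by blast
qed

section \<open>Consequences of the grid assumptions\<close>

locale storage_grid =
  fixes G :: "('n::finite) grid"
  assumes grid: "grid_ok G"
begin

text \<open>The voltage limits hold for the bare loads by assumption, so idle batteries are
  available as a fallback plan and as the endpoint of every scaling.\<close>

lemma admissible_zero:
  assumes "signal_ok G \<xi>"
  shows "admissible G \<xi> 0"
  using assms grid by (simp add: admissible_def signal_ok_def grid_ok_def)

text \<open>All charges of one period have the same sign and \<open>R\<close> is entrywise nonnegative, so that
  shrinking some of them moves every voltage towards its value without batteries.\<close>

lemma admissible_shrink:
  assumes ok: "signal_ok G \<xi>" and b: "admissible G \<xi> b"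
    and seg: "\<And>n. b' $ n \<in> closed_segment 0 (b $ n)"
  shows "admissible G \<xi> b'"
proof -
  have R: "Rmat G *v x \<le> Rmat G *v y" if "x \<le> y" for x y :: "real^'n"
    using that grid
    by (auto simp: less_eq_vec_def matrix_vector_mult_def grid_ok_def intro!: sum_mono mult_left_mono)
  have box: "b_lo G \<le> 0" "0 \<le> b_hi G"
    using grid by (auto simp: grid_ok_def)
  have volt: "voltage_ok G p (reac \<xi>)"
    if "p1 \<le> p" "p \<le> p2" "voltage_ok G p1 (reac \<xi>)" "voltage_ok G p2 (reac \<xi>)" for p p1 p2
  proof -
    let ?V = "\<lambda>p. - (Rmat G *v p) - Xmat G *v reac \<xi>"
    have "?V p2 \<le> ?V p" "?V p \<le> ?V p1"
      using R[OF that(1)] R[OF that(2)] by (auto simp: less_eq_vec_def)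
    then show ?thesis
      using that(3,4) unfolding voltage_ok_def by (blast intro: order_trans)
  qed
  have reg: "reg \<xi> = 1 \<or> reg \<xi> = -1" and volt0: "voltage_ok G (load \<xi>) (reac \<xi>)"
    using ok by (auto simp: signal_ok_def)
  from reg show ?thesis
  proof
    assume r: "reg \<xi> = 1"
    then have "0 \<le> b" using b by (simp add: admissible_def)
    then have "0 \<le> b'" "b' \<le> b"
      using seg by (auto simp: less_eq_vec_def closed_segment_eq_real_ivl split: if_splits)
    moreover from this have "voltage_ok G (load \<xi> + b') (reac \<xi>)"
      using volt[of "load \<xi>" "load \<xi> + b'" "load \<xi> + b"] volt0 b
      by (auto simp: admissible_def less_eq_vec_def)
    ultimately show ?thesis
      using b r box unfolding admissible_def by (auto intro: order_trans)
  next
    assume r: "reg \<xi> = -1"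
    then have "b \<le> 0" using b by (simp add: admissible_def)
    then have "b' $ n \<le> 0 \<and> b $ n \<le> b' $ n" for n
    proof -
      have "b $ n \<le> 0" using \<open>b \<le> 0\<close> by (simp add: less_eq_vec_def)
      with seg[of n] show ?thesis
        by (auto simp: closed_segment_eq_real_ivl split: if_splits)
    qed
    then have "b' \<le> 0" "b \<le> b'"
      by (auto simp: less_eq_vec_def)
    moreover from this have "voltage_ok G (load \<xi> + b') (reac \<xi>)"
      using volt[of "load \<xi> + b" "load \<xi> + b'" "load \<xi>"] volt0 b
      by (auto simp: admissible_def less_eq_vec_def)
    ultimately show ?thesis
      using b r box unfolding admissible_def by (auto intro: order_trans)
  qed
qed

lemma bounded_of_continuous:
  fixes f :: "'n data \<Rightarrow> real^'n \<Rightarrow> real^'n \<Rightarrow> real"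
  assumes "continuous_on UNIV (\<lambda>p. f (fst p) (fst (snd p)) (snd (snd p)))"
  shows "\<exists>C\<ge>0. \<forall>\<xi> b b'. signal_ok G \<xi> \<longrightarrow> b_lo G \<le> b \<and> b \<le> b_hi G \<longrightarrow>
    b_lo G \<le> b' \<and> b' \<le> b_hi G \<longrightarrow> \<bar>f (signal_tuple \<xi>) b b'\<bar> \<le> C"
proof -
  let ?K = "{x. signal_ok G (sig_of x)} \<times> cbox (b_lo G) (b_hi G) \<times> cbox (b_lo G) (b_hi G)"
  have "compact ?K"
    by (intro compact_Times compact_signals compact_cbox)
  then have "compact ((\<lambda>p. f (fst p) (fst (snd p)) (snd (snd p))) ` ?K)"
    using assms by (intro compact_continuous_image) (auto intro: continuous_on_subset)
  from compact_imp_bounded[OF this, unfolded bounded_iff]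
  obtain C where C: "\<forall>y\<in>(\<lambda>p. f (fst p) (fst (snd p)) (snd (snd p))) ` ?K. norm y \<le> C" ..
  have "\<bar>f (signal_tuple \<xi>) b b'\<bar> \<le> \<bar>C\<bar>"
    if "signal_ok G \<xi>" "b_lo G \<le> b \<and> b \<le> b_hi G" "b_lo G \<le> b' \<and> b' \<le> b_hi G" for \<xi> b b'
  proof -
    have "(signal_tuple \<xi>, b, b') \<in> ?K"
      using that by (auto simp: interval_cbox_cart[symmetric])
    from bspec[OF C imageI, OF this] show ?thesis
      by simp
  qed
  then show ?thesis
    by (intro exI[of _ "\<bar>C\<bar>"]) auto
qed

lemma agg_cost_bounded:
  "\<exists>C\<ge>0. \<forall>\<xi> b. signal_ok G \<xi> \<longrightarrow> b_lo G \<le> b \<and> b \<le> b_hi G \<longrightarrow> \<bar>agg_cost \<xi> b\<bar> \<le> C"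
proof -
  have "continuous_on UNIV (\<lambda>p :: 'n data \<times> (real^'n) \<times> (real^'n).
      (\<lambda>x b b'. agg_cost (sig_of x) b) (fst p) (fst (snd p)) (snd (snd p)))"
    by (intro continuous_intros)
  from bounded_of_continuous[OF this] show ?thesis
    by auto
qed

lemma agg_cost_lipschitz:
  "\<exists>C\<ge>0. \<forall>\<xi> b b'. signal_ok G \<xi> \<longrightarrow> b_lo G \<le> b \<and> b \<le> b_hi G \<longrightarrow>
    b_lo G \<le> b' \<and> b' \<le> b_hi G \<longrightarrow>
    agg_cost \<xi> b' \<le> agg_cost \<xi> b + C * (\<Sum>n\<in>UNIV. \<bar>b $ n - b' $ n\<bar>)"
proof -
  \<comment> \<open>The coordinatewise difference quotient of the quadratic cost, obtained by
    factoring each difference of squares into difference times sum.\<close>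
  define g where "g \<xi> b b' n = cp \<xi> / 2 * ((\<Sum>m\<in>UNIV. (load \<xi> + b) $ m) + (\<Sum>m\<in>UNIV. (load \<xi> + b') $ m))
      + c0 \<xi> + cp \<xi> / 2 * ((load \<xi> + b) $ n + (load \<xi> + b') $ n) - reg \<xi> * cr \<xi>"
    for \<xi> :: "'n signal" and b b' and n
  have diff: "agg_cost \<xi> b' - agg_cost \<xi> b = (\<Sum>n\<in>UNIV. (b' $ n - b $ n) * g \<xi> b b' n)" for \<xi> b b'
  proof -
    let ?S = "\<lambda>b. \<Sum>m\<in>UNIV. (load \<xi> + b) $ m"
    let ?t = "\<lambda>c n. c0 \<xi> * (load \<xi> + c) $ n + cp \<xi> * ((load \<xi> + c) $ n)\<^sup>2 / 2 - reg \<xi> * cr \<xi> * c $ n"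
    have "(\<Sum>n\<in>UNIV. (b' $ n - b $ n) * g \<xi> b b' n) =
      (\<Sum>n\<in>UNIV. ((load \<xi> + b') $ n - (load \<xi> + b) $ n) * (cp \<xi> / 2 * (?S b + ?S b')) + (?t b' n - ?t b n))"
      by (intro sum.cong) (auto simp: g_def field_simps power2_eq_square)
    also have "\<dots> = (?S b' - ?S b) * (cp \<xi> / 2 * (?S b + ?S b')) + ((\<Sum>n\<in>UNIV. ?t b' n) - (\<Sum>n\<in>UNIV. ?t b n))"
      by (simp only: sum.distrib sum_subtractf sum_distrib_right[symmetric])
    finally show ?thesis
      by (simp add: agg_cost_def field_simps power2_eq_square)
  qed
  have "continuous_on UNIV (\<lambda>p :: 'n data \<times> (real^'n) \<times> (real^'n).
      (\<lambda>x b b'. \<Sum>n\<in>UNIV. \<bar>g (sig_of x) b b' n\<bar>) (fst p) (fst (snd p)) (snd (snd p)))"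
    unfolding g_def sig_of_def by (auto intro!: continuous_intros)
  from bounded_of_continuous[OF this] obtain C where "0 \<le> C" and
    C: "\<forall>\<xi> b b'. signal_ok G \<xi> \<longrightarrow> b_lo G \<le> b \<and> b \<le> b_hi G \<longrightarrow>
      b_lo G \<le> b' \<and> b' \<le> b_hi G \<longrightarrow> (\<Sum>n\<in>UNIV. \<bar>g \<xi> b b' n\<bar>) \<le> C"
    by auto
  have "agg_cost \<xi> b' \<le> agg_cost \<xi> b + C * (\<Sum>n\<in>UNIV. \<bar>b $ n - b' $ n\<bar>)"
    if *: "signal_ok G \<xi>" "b_lo G \<le> b \<and> b \<le> b_hi G" "b_lo G \<le> b' \<and> b' \<le> b_hi G" for \<xi> b b'
  proof -
    have "(b' $ n - b $ n) * g \<xi> b b' n \<le> C * \<bar>b $ n - b' $ n\<bar>" for n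
    proof -
      have "\<bar>g \<xi> b b' n\<bar> \<le> (\<Sum>n\<in>UNIV. \<bar>g \<xi> b b' n\<bar>)"
        by (intro member_le_sum) auto
      also have "\<dots> \<le> C" using C * by blast
      finally have "\<bar>b' $ n - b $ n\<bar> * \<bar>g \<xi> b b' n\<bar> \<le> \<bar>b' $ n - b $ n\<bar> * C"
        by (intro mult_left_mono) auto
      moreover have "(b' $ n - b $ n) * g \<xi> b b' n \<le> \<bar>b' $ n - b $ n\<bar> * \<bar>g \<xi> b b' n\<bar>"
        unfolding abs_mult[symmetric] by (rule abs_ge_self)
      ultimately show ?thesis
        unfolding abs_minus_commute[of "b $ n"] mult.commute[of C] by (rule order_trans[rotated])
    qed
    then have "agg_cost \<xi> b' - agg_cost \<xi> b \<le> (\<Sum>n\<in>UNIV. C * \<bar>b $ n - b' $ n\<bar>)"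
      unfolding diff by (intro sum_mono)
    then show ?thesis
      by (simp add: sum_distrib_left)
  qed
  then show ?thesis
    using \<open>0 \<le> C\<close> by blast
qed

end

subsection \<open>Optimal blocks\<close>

text \<open>Vanishing from \<open>T\<close> on places the decisions in a compact product and leaves
  no freedom beyond the periods that the cost sees, so minimizers can be unique. The state is
  constrained up to index \<open>T\<close> inclusive, since the final state starts the next
  block.\<close>

definition block_feasible ::
    "('n::finite) grid \<Rightarrow> nat \<Rightarrow> real^'n \<Rightarrow> (nat \<Rightarrow> 'n data) \<Rightarrow> (nat \<Rightarrow> real^'n) \<Rightarrow> bool" where
  "block_feasible G T s x b \<longleftrightarrow>
    (\<forall>i<T. signal_ok G (sig_of (x i)) \<and> admissible G (sig_of (x i)) (b i)) \<and>
    (\<forall>i\<le>T. s_lo G \<le> s + (\<Sum>k<i. b k) \<and> s + (\<Sum>k<i. b k) \<le> s_hi G) \<and> (\<forall>i\<ge>T. b i = 0)"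

definition block_cost :: "nat \<Rightarrow> (nat \<Rightarrow> ('n::finite) data) \<Rightarrow> (nat \<Rightarrow> real^'n) \<Rightarrow> real" where
  "block_cost T x b = (\<Sum>i<T. agg_cost (sig_of (x i)) (b i))"

lemma less_max_of_less_mean: "x < max y z" if "x < (y + z) / 2" for x y z :: real
  using that by (auto simp: max_def field_simps)

lemma block_feasible_soc:
  assumes "block_feasible G T s x b"
  shows "s_lo G \<le> s + (\<Sum>k<i. b k) \<and> s + (\<Sum>k<i. b k) \<le> s_hi G"
proof (cases "i \<le> T")
  case False
  have "(\<Sum>k<i. b k) = (\<Sum>k<T. b k)"
    using assms False by (intro sum.mono_neutral_right) (auto simp: block_feasible_def)
  then show ?thesis using assms by (simp add: block_feasible_def)
qed (use assms in \<open>auto simp: block_feasible_def\<close>)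

lemma closed_block_feasible:
  "closed {p :: ((real^'n) \<times> (nat \<Rightarrow> ('n::finite) data)) \<times> (nat \<Rightarrow> real^'n).
    block_feasible G T (fst (fst p)) (snd (fst p)) (snd p)}" (is "closed ?F")
proof -
  have "?F = (\<Inter>i\<in>{..<T}. {p. signal_ok G (sig_of (snd (fst p) i)) \<and> admissible G (sig_of (snd (fst p) i)) (snd p i)})
      \<inter> (\<Inter>i\<in>{..T}. {p. s_lo G \<le> fst (fst p) + (\<Sum>k<i. snd p k)} \<inter> {p. fst (fst p) + (\<Sum>k<i. snd p k) \<le> s_hi G})
      \<inter> (\<Inter>i\<in>{T..}. {p. snd p i = 0})"
    by (auto simp: block_feasible_def)
  also have "closed \<dots>"
    by (intro closed_Int closed_INT ballI closed_admissible closed_Collect_vec_le closed_Collect_eq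
        continuous_intros continuous_on_product_then_coordinatewise)
  finally show ?thesis .
qed

lemma compact_block_decisions:
  fixes lo hi :: "real^'n::finite"
  shows "compact {b :: nat \<Rightarrow> real^'n. \<forall>i. b i \<in> (if i < T then {lo..hi} else {0})}"
proof -
  have "compactin (product_topology (\<lambda>i. euclidean) UNIV) (PiE UNIV (\<lambda>i::nat. if i < T then {lo..hi} else {0}))"
    unfolding compactin_PiE by (auto simp: interval_cbox_cart)
  then show ?thesis
    unfolding euclidean_product_topology by (simp add: PiE_def Pi_def)
qed

lemma block_feasible_convex:
  assumes a: "block_feasible G T s x a" and b: "block_feasible G T s x b" and u: "0 \<le> u" "u \<le> 1"
  shows "block_feasible G T s x (\<lambda>i. (1 - u) *\<^sub>R a i + u *\<^sub>R b i)"
proof -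
  have eq: "s + (\<Sum>k<i. (1 - u) *\<^sub>R a k + u *\<^sub>R b k) =
      (1 - u) *\<^sub>R (s + (\<Sum>k<i. a k)) + u *\<^sub>R (s + (\<Sum>k<i. b k))" for i
    unfolding sum.distrib scaleR_sum_right[symmetric] by (simp add: algebra_simps)
  have "s_lo G \<le> (1 - u) *\<^sub>R (s + (\<Sum>k<i. a k)) + u *\<^sub>R (s + (\<Sum>k<i. b k))" for i
    using convex_combination_mono[OF conjunct1[OF block_feasible_soc[OF a]] conjunct1[OF block_feasible_soc[OF b]] u]
    unfolding convex_combination_same .
  moreover have "(1 - u) *\<^sub>R (s + (\<Sum>k<i. a k)) + u *\<^sub>R (s + (\<Sum>k<i. b k)) \<le> s_hi G" for i
    using convex_combination_mono[OF conjunct2[OF block_feasible_soc[OF a]] conjunct2[OF block_feasible_soc[OF b]] u]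
    unfolding convex_combination_same .
  ultimately show ?thesis
    using a b u unfolding block_feasible_def eq by (auto intro: admissible_convex)
qed

context storage_grid
begin

lemma block_feasible_zero:
  assumes "\<And>i. i < T \<Longrightarrow> signal_ok G (sig_of (x i))" and "s_lo G \<le> s" and "s \<le> s_hi G"
  shows "block_feasible G T s x (\<lambda>_. 0)"
  using assms by (auto simp: block_feasible_def admissible_zero)

lemma agg_cost_midpoint_less:
  assumes "signal_ok G \<xi>" and "a \<noteq> b"
  shows "agg_cost \<xi> ((1 - 1/2) *\<^sub>R a + (1/2) *\<^sub>R b) < (agg_cost \<xi> a + agg_cost \<xi> b) / 2"
proof -
  have cp: "0 < cp_lo G" "cp_lo G \<le> cp \<xi>"
    using assms grid by (auto simp: grid_ok_def signal_ok_def)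
  have "0 < cp_lo G / 2 * (norm (b - a))\<^sup>2"
    using cp assms by simp
  also have "\<dots> \<le> cost_gap \<xi> (b - a)"
    using cp by (intro cost_gap_ge) auto
  finally show ?thesis
    unfolding agg_cost_convex_combination by simp
qed

text \<open>\<open>H\<close> sees all data of the block in advance, as an offline decision may.
  Joint measurability in state and data is essential, because the state it is applied to is itself
  random. Strict convexity in one period in which two plans differ is enough for uniqueness.\<close>

lemma block_optimizer:
  "\<exists>H :: (real^'n) \<times> (nat \<Rightarrow> 'n data) \<Rightarrow> nat \<Rightarrow> real^'n. H \<in> borel_measurable borel \<and>
    (\<forall>s x b. block_feasible G T s x b \<longrightarrow>
      block_feasible G T s x (H (s, x)) \<and> block_cost T x (H (s, x)) \<le> block_cost T x b)"
proof -
  let ?F = "{p. block_feasible G T (fst (fst p)) (snd (fst p)) (snd p)}"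
  let ?c = "\<lambda>a b. block_cost T (snd a) b"
  let ?K = "{b :: nat \<Rightarrow> real^'n. \<forall>i. b i \<in> (if i < T then {b_lo G..b_hi G} else {0})}"
  have FK: "?F \<subseteq> UNIV \<times> ?K"
    by (auto simp: block_feasible_def admissible_def)
  have cont: "continuous_on ?F (\<lambda>p. ?c (fst p) (snd p))"
    unfolding block_cost_def by (intro continuous_intros continuous_on_product_then_coordinatewise)
  have conv: "\<exists>m. (a, m) \<in> ?F \<and> ?c a m < max (?c a b) (?c a b')"
    if F: "(a, b) \<in> ?F" "(a, b') \<in> ?F" and ne: "b \<noteq> b'" for a b b'
  proof (intro exI conjI)
    let ?m = "\<lambda>i. (1 - 1/2) *\<^sub>R b i + (1/2) *\<^sub>R b' i"
    show "(a, ?m) \<in> ?F"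
      using F block_feasible_convex[of G T "fst a" "snd a" b b' "1/2"] by simp
    from ne obtain j where j: "b j \<noteq> b' j" by auto
    have feas: "block_feasible G T (fst a) (snd a) b" "block_feasible G T (fst a) (snd a) b'"
      using F by auto
    then have zero: "b i = 0" "b' i = 0" if "T \<le> i" for i
      using that unfolding block_feasible_def by blast+
    have ok: "signal_ok G (sig_of (snd a i))" if "i < T" for i
      using feas(1) that unfolding block_feasible_def by blast
    have "j < T"
      using j zero[of j] by (cases "j < T") auto
    have le: "agg_cost (sig_of (snd a i)) (?m i) \<le>
        (agg_cost (sig_of (snd a i)) (b i) + agg_cost (sig_of (snd a i)) (b' i)) / 2" if "i < T" for i
    proof (cases "b i = b' i")
      case True
      then show ?thesis by (simp only: convex_combination_same) simp
    next
      case False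
      show ?thesis
        by (rule less_imp_le, rule agg_cost_midpoint_less[OF ok[OF that] False])
    qed
    have "?c a ?m < (\<Sum>i<T. (agg_cost (sig_of (snd a i)) (b i) + agg_cost (sig_of (snd a i)) (b' i)) / 2)"
      unfolding block_cost_def
    proof (rule sum_strict_mono_ex1)
      show "\<exists>i\<in>{..<T}. agg_cost (sig_of (snd a i)) (?m i) <
          (agg_cost (sig_of (snd a i)) (b i) + agg_cost (sig_of (snd a i)) (b' i)) / 2"
        using agg_cost_midpoint_less[OF ok[OF \<open>j < T\<close>] j] \<open>j < T\<close> by blast
    qed (use le in auto)
    also have "\<dots> = (?c a b + ?c a b') / 2"
      unfolding block_cost_def sum_divide_distrib[symmetric] sum.distrib ..
    finally show "?c a ?m < max (?c a b) (?c a b')"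
      by (rule less_max_of_less_mean)
  qed
  from measurable_argmin[OF closed_block_feasible compact_block_decisions FK cont conv]
  obtain H :: "(real^'n) \<times> (nat \<Rightarrow> 'n data) \<Rightarrow> nat \<Rightarrow> real^'n" where "H \<in> borel_measurable borel \<and>
    (\<forall>a b. (a, b) \<in> ?F \<longrightarrow> (a, H a) \<in> ?F \<and> ?c a (H a) \<le> ?c a b \<and> (?c a b \<le> ?c a (H a) \<longrightarrow> b = H a))" ..
  then show ?thesis
    by (intro exI[of _ H]) auto
qed

text \<open>\<open>E\<close> is chosen before \<open>T\<close>. Whatever the length of the block,
  tracking omits charges amounting to at most one battery range per user, so the Lipschitz constant
  times the sum of these ranges suffices, and the share of \<open>E\<close> per period vanishes for
  long blocks.\<close>

lemma block_switch_cost: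
  "\<exists>E. \<forall>T s s' x b. block_feasible G T s x b \<longrightarrow> s_lo G \<le> s' \<and> s' \<le> s_hi G \<longrightarrow>
    (\<exists>b'. block_feasible G T s' x b' \<and> block_cost T x b' \<le> block_cost T x b + E)"
proof -
  from agg_cost_lipschitz obtain C where "0 \<le> C" and
    C: "\<forall>\<xi> b b'. signal_ok G \<xi> \<longrightarrow> b_lo G \<le> b \<and> b \<le> b_hi G \<longrightarrow> b_lo G \<le> b' \<and> b' \<le> b_hi G \<longrightarrow>
      agg_cost \<xi> b' \<le> agg_cost \<xi> b + C * (\<Sum>n\<in>UNIV. \<bar>b $ n - b' $ n\<bar>)"
    by auto
  let ?E = "C * (\<Sum>n\<in>UNIV. s_hi G $ n - s_lo G $ n)"
  have "\<exists>b'. block_feasible G T s' x b' \<and> block_cost T x b' \<le> block_cost T x b + ?E"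
    if b: "block_feasible G T s x b" and s': "s_lo G \<le> s'" "s' \<le> s_hi G" for T s s' x b
  proof -
    obtain b' where soc: "\<And>i. s_lo G \<le> s' + (\<Sum>k<i. b' k) \<and> s' + (\<Sum>k<i. b' k) \<le> s_hi G"
      and seg: "\<And>i n. b' i $ n \<in> closed_segment 0 (b i $ n)"
      and dist: "\<And>T n. (\<Sum>i<T. \<bar>b i $ n - b' i $ n\<bar>) \<le> s_hi G $ n - s_lo G $ n"
      using vector_tracking[OF block_feasible_soc[OF b] s'] by blast
    have ok: "signal_ok G (sig_of (x i))" "admissible G (sig_of (x i)) (b i)" if "i < T" for i
      using b that by (auto simp: block_feasible_def)
    have adm: "admissible G (sig_of (x i)) (b' i)" if "i < T" for i
      using admissible_shrink[OF ok[OF that]] seg by blast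
    have zero: "b' i = 0" if "i \<ge> T" for i
      using b seg[of i] that by (auto simp: block_feasible_def vec_eq_iff)
    have "block_feasible G T s' x b'"
      unfolding block_feasible_def using soc ok(1) adm zero by blast
    moreover have "block_cost T x b' \<le> (\<Sum>i<T. agg_cost (sig_of (x i)) (b i) + C * (\<Sum>n\<in>UNIV. \<bar>b i $ n - b' i $ n\<bar>))"
      unfolding block_cost_def
    proof (rule sum_mono)
      fix i assume "i \<in> {..<T}"
      then have i: "i < T" by simp
      have "b_lo G \<le> b i \<and> b i \<le> b_hi G" "b_lo G \<le> b' i \<and> b' i \<le> b_hi G"
        using ok(2)[OF i] adm[OF i] unfolding admissible_def by blast+
      then show "agg_cost (sig_of (x i)) (b' i) \<le>
          agg_cost (sig_of (x i)) (b i) + C * (\<Sum>n\<in>UNIV. \<bar>b i $ n - b' i $ n\<bar>)"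
        using C ok(1)[OF i] by blast
    qed
    moreover have "\<dots> = block_cost T x b + C * (\<Sum>n\<in>UNIV. \<Sum>i<T. \<bar>b i $ n - b' i $ n\<bar>)"
      unfolding block_cost_def sum.distrib sum_distrib_left[symmetric] by (subst sum.swap) (rule refl)
    moreover have "C * (\<Sum>n\<in>UNIV. \<Sum>i<T. \<bar>b i $ n - b' i $ n\<bar>) \<le> ?E"
      using dist \<open>0 \<le> C\<close> by (intro mult_left_mono sum_mono)
    ultimately show ?thesis
      by (intro exI[of _ b']) linarith
  qed
  then show ?thesis by blast
qed

text \<open>The uniqueness clause lets real-time decisions, given only as pathwise minimizers, be
  replaced by this function of the multiplier and the current data.\<close>

lemma one_period_optimizer:
  "\<exists>h :: (real^'n) \<times> 'n data \<Rightarrow> real^'n. h \<in> borel_measurable borel \<and>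
    (\<forall>y x b. signal_ok G (sig_of x) \<longrightarrow> admissible G (sig_of x) b \<longrightarrow>
      admissible G (sig_of x) (h (y, x)) \<and>
      y \<bullet> h (y, x) + agg_cost (sig_of x) (h (y, x)) \<le> y \<bullet> b + agg_cost (sig_of x) b \<and>
      (y \<bullet> b + agg_cost (sig_of x) b \<le> y \<bullet> h (y, x) + agg_cost (sig_of x) (h (y, x)) \<longrightarrow> b = h (y, x)))"
proof -
  let ?F = "{p :: ((real^'n) \<times> 'n data) \<times> (real^'n).
    signal_ok G (sig_of (snd (fst p))) \<and> admissible G (sig_of (snd (fst p))) (snd p)}"
  let ?c = "\<lambda>a b. fst a \<bullet> b + agg_cost (sig_of (snd a)) b"
  have F: "closed ?F"
    by (intro closed_admissible continuous_intros)
  have FK: "?F \<subseteq> UNIV \<times> cbox (b_lo G) (b_hi G)"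
    by (auto simp: admissible_def interval_cbox_cart[symmetric])
  have cont: "continuous_on ?F (\<lambda>p. ?c (fst p) (snd p))"
    by (intro continuous_intros)
  have conv: "\<exists>m. (a, m) \<in> ?F \<and> ?c a m < max (?c a b) (?c a b')"
    if F: "(a, b) \<in> ?F" "(a, b') \<in> ?F" and ne: "b \<noteq> b'" for a b b'
  proof (intro exI conjI)
    let ?m = "(1 - 1/2) *\<^sub>R b + (1/2) *\<^sub>R b'"
    show "(a, ?m) \<in> ?F"
      unfolding mem_Collect_eq fst_conv snd_conv
      by (intro conjI admissible_convex) (use F in auto)
    have "fst a \<bullet> ?m = (fst a \<bullet> b + fst a \<bullet> b') / 2"
      unfolding inner_add_right inner_scaleR_right by simp
    moreover have "agg_cost (sig_of (snd a)) ?m < (agg_cost (sig_of (snd a)) b + agg_cost (sig_of (snd a)) b') / 2"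
      using F ne by (intro agg_cost_midpoint_less) auto
    ultimately have "?c a ?m < (?c a b + ?c a b') / 2"
      by argo
    then show "?c a ?m < max (?c a b) (?c a b')"
      by (rule less_max_of_less_mean)
  qed
  from measurable_argmin[OF F compact_cbox FK cont conv]
  obtain h :: "(real^'n) \<times> 'n data \<Rightarrow> real^'n" where "h \<in> borel_measurable borel \<and>
    (\<forall>a b. (a, b) \<in> ?F \<longrightarrow> (a, h a) \<in> ?F \<and> ?c a (h a) \<le> ?c a b \<and> (?c a b \<le> ?c a (h a) \<longrightarrow> b = h a))" ..
  then show ?thesis
    by (intro exI[of _ h]) auto
qed

end

subsection \<open>Random data\<close>

locale storage_game = storage_grid G + prob_space M
  for G :: "('n::finite) grid" and M :: "'w measure" +
  fixes \<Xi> :: "nat \<Rightarrow> 'w \<Rightarrow> 'n signal"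
  assumes iid: "iid_signals M G \<Xi>"
begin

definition X :: "nat \<Rightarrow> 'w \<Rightarrow> 'n data" where
  "X = (\<lambda>t \<omega>. signal_tuple (\<Xi> t \<omega>))"

lemma sig_of_X [simp]: "sig_of (X t \<omega>) = \<Xi> t \<omega>"
  by (simp add: X_def)

lemma indep_X: "indep_vars (\<lambda>_. borel) X UNIV"
  using iid by (simp add: iid_signals_def X_def)

lemma measurable_X [measurable]: "X t \<in> borel_measurable M"
  using indep_X by (auto simp: indep_vars_def2)

lemma distr_X: "distr M borel (X t) = distr M borel (X 0)"
  using iid by (simp add: iid_signals_def X_def)

lemma AE_signal_ok: "AE \<omega> in M. \<forall>t. signal_ok G (\<Xi> t \<omega>)"
  using iid by (simp add: iid_signals_def)

lemma measurable_X_seq [measurable]: "(\<lambda>\<omega> i. X (k + i) \<omega>) \<in> borel_measurable M"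
  by (rule measurable_coordinatewise_then_product) measurable

text \<open>Independence with identical marginals makes the law of the whole sequence an infinite
  power of one measure, which injective reindexing preserves. Whole sequences are needed because
  block costs depend on many periods jointly.\<close>

lemma distr_X_shift: "distr M borel (\<lambda>\<omega> i. X (k + i) \<omega>) = distr M borel (\<lambda>\<omega> i. X i \<omega>)"
proof -
  let ?P = "\<Pi>\<^sub>M i\<in>UNIV::nat set. (borel :: 'n data measure)"
  let ?L = "distr M borel (X 0)"
  let ?Q = "\<Pi>\<^sub>M i\<in>UNIV::nat set. ?L"
  have P: "sets ?P = sets (borel :: (nat \<Rightarrow> 'n data) measure)"
    by (rule sets_PiM_equal_borel)
  have QP: "sets ?Q = sets ?P"
    by (intro sets_PiM_cong) auto
  have meas: "(\<lambda>\<omega> i. X (k + i) \<omega>) \<in> measurable M ?P" for k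
    using measurable_X_seq[of k] unfolding measurable_cong_sets[OF refl P] .
  have "distr M ?P (\<lambda>\<omega>. \<lambda>i\<in>UNIV. X i \<omega>) = (\<Pi>\<^sub>M i\<in>UNIV. distr M borel (X i))"
    using indep_X by (subst (asm) indep_vars_iff_distr_eq_PiM) auto
  also have "\<dots> = ?Q"
    by (rule PiM_cong[OF refl distr_X])
  finally have joint: "distr M ?P (\<lambda>\<omega> i. X i \<omega>) = ?Q"
    by (simp add: restrict_def)
  have "prob_space ?L"
    by (rule prob_space_distr) measurable
  then have "distr ?Q ?Q (\<lambda>x. \<lambda>n\<in>UNIV. x (k + n)) = ?Q"
    by (intro distr_PiM_reindex[where M = "\<lambda>_. ?L" and f = "\<lambda>n. k + n" and K = UNIV and I = UNIV]) auto
  moreover have "distr ?Q ?Q (\<lambda>x. \<lambda>n\<in>UNIV. x (k + n)) = distr ?Q ?P (\<lambda>x n. x (k + n))"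
    using QP by (intro distr_cong) auto
  ultimately have shift: "distr ?Q ?P (\<lambda>x n. x (k + n)) = ?Q"
    by simp
  have "distr M ?P (\<lambda>\<omega> i. X (k + i) \<omega>) = distr (distr M ?P (\<lambda>\<omega> i. X i \<omega>)) ?P (\<lambda>x n. x (k + n))"
    using meas[of 0] by (subst distr_distr) (auto simp: comp_def intro!: measurable_PiM_single')
  also have "\<dots> = distr M ?P (\<lambda>\<omega> i. X i \<omega>)"
    unfolding joint shift ..
  finally have "distr M ?P (\<lambda>\<omega> i. X (k + i) \<omega>) = distr M ?P (\<lambda>\<omega> i. X i \<omega>)" .
  moreover have "distr M borel f = distr M ?P f" for f
    using P by (intro distr_cong) auto
  ultimately show ?thesis
    by simp
qed

lemma integral_X_shift:
  fixes \<phi> :: "(nat \<Rightarrow> 'n data) \<Rightarrow> real"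
  assumes [measurable]: "\<phi> \<in> borel_measurable borel"
  shows "(\<integral>\<omega>. \<phi> (\<lambda>i. X (k + i) \<omega>) \<partial>M) = (\<integral>\<omega>. \<phi> (\<lambda>i. X i \<omega>) \<partial>M)"
proof -
  have eq: "(\<integral>\<omega>. \<phi> (\<lambda>i. X (k + i) \<omega>) \<partial>M) = (\<integral>x. \<phi> x \<partial>distr M borel (\<lambda>\<omega> i. X (k + i) \<omega>))" for k
    by (rule integral_distr[symmetric]) measurable
  show ?thesis
    using eq[of k] eq[of 0] by (simp add: distr_X_shift[of k])
qed

lemma measurable_agg_cost:
  fixes f :: "'b \<Rightarrow> 'n data"
  assumes "f \<in> borel_measurable N" and "g \<in> borel_measurable N"
  shows "(\<lambda>\<omega>. agg_cost (sig_of (f \<omega>)) (g \<omega>)) \<in> borel_measurable N"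
  by (rule borel_measurable_continuous_Pair[OF assms]) (intro continuous_intros)

lemma integrable_agg_cost:
  assumes "b \<in> borel_measurable M" and "AE \<omega> in M. admissible G (\<Xi> t \<omega>) (b \<omega>)"
  shows "integrable M (\<lambda>\<omega>. agg_cost (\<Xi> t \<omega>) (b \<omega>))"
proof -
  obtain C where C: "\<forall>\<xi> b. signal_ok G \<xi> \<longrightarrow> b_lo G \<le> b \<and> b \<le> b_hi G \<longrightarrow> \<bar>agg_cost \<xi> b\<bar> \<le> C"
    using agg_cost_bounded by blast
  have "AE \<omega> in M. norm (agg_cost (\<Xi> t \<omega>) (b \<omega>)) \<le> C"
    using AE_signal_ok assms(2) by eventually_elim (use C in \<open>auto simp: admissible_def\<close>)
  then show ?thesis
    using measurable_agg_cost[OF measurable_X[of t] assms(1)] by (intro integrable_const_bound) auto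
qed

lemma exp_agg_cost_bounded:
  "\<exists>C\<ge>0. \<forall>t b. b t \<in> borel_measurable M \<longrightarrow> (AE \<omega> in M. admissible G (\<Xi> t \<omega>) (b t \<omega>)) \<longrightarrow>
    \<bar>exp_agg_cost M \<Xi> b t\<bar> \<le> C"
proof -
  obtain C where "0 \<le> C" and C: "\<forall>\<xi> b. signal_ok G \<xi> \<longrightarrow> b_lo G \<le> b \<and> b \<le> b_hi G \<longrightarrow> \<bar>agg_cost \<xi> b\<bar> \<le> C"
    using agg_cost_bounded by blast
  have "\<bar>exp_agg_cost M \<Xi> b t\<bar> \<le> C"
    if b: "b t \<in> borel_measurable M" "AE \<omega> in M. admissible G (\<Xi> t \<omega>) (b t \<omega>)" for t b
  proof -
    have ae: "AE \<omega> in M. \<bar>agg_cost (\<Xi> t \<omega>) (b t \<omega>)\<bar> \<le> C"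
      using AE_signal_ok b(2) by eventually_elim (use C in \<open>auto simp: admissible_def\<close>)
    have "AE \<omega> in M. agg_cost (\<Xi> t \<omega>) (b t \<omega>) \<le> C" "AE \<omega> in M. - C \<le> agg_cost (\<Xi> t \<omega>) (b t \<omega>)"
      by (rule eventually_mono[OF ae], simp)+
    from integral_le_const[OF integrable_agg_cost[OF b] this(1)]
      integral_ge_const[OF integrable_agg_cost[OF b] this(2)]
    show ?thesis
      by (simp add: exp_agg_cost_def abs_le_iff)
  qed
  then show ?thesis
    using \<open>0 \<le> C\<close> by blast
qed

lemma feasible_measurable: "feasible M G \<Xi> b \<Longrightarrow> b t \<in> borel_measurable M"
  by (simp add: feasible_def)

lemma feasible_admissible: "feasible M G \<Xi> b \<Longrightarrow> AE \<omega> in M. admissible G (\<Xi> t \<omega>) (b t \<omega>)"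
  unfolding feasible_def by auto

lemma block_cost_X: "block_cost T (\<lambda>i. X (k + i) \<omega>) b = (\<Sum>i<T. agg_cost (\<Xi> (k + i) \<omega>) (b i))"
  by (simp add: block_cost_def)

lemma AE_block_admissible:
  assumes "AE \<omega> in M. block_feasible G T (z \<omega>) (\<lambda>i. X (k + i) \<omega>) (\<lambda>i. \<beta> i \<omega>)" and "i < T"
  shows "AE \<omega> in M. admissible G (\<Xi> (k + i) \<omega>) (\<beta> i \<omega>)"
  using assms(1) by eventually_elim (use assms(2) in \<open>auto simp: block_feasible_def\<close>)

lemma exp_agg_cost_zero: "exp_agg_cost M \<Xi> (\<lambda>_ _. 0) t = exp_agg_cost M \<Xi> (\<lambda>_ _. 0) 0"
proof -
  have "(\<lambda>x. agg_cost (sig_of (x 0)) 0) \<in> borel_measurable (borel :: (nat \<Rightarrow> 'n data) measure)"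
    by (intro borel_measurable_continuous_onI continuous_intros continuous_on_product_then_coordinatewise)
  from integral_X_shift[OF this, of t] show ?thesis
    by (simp add: exp_agg_cost_def)
qed

lemma measurable_block_optimizer:
  assumes H: "H \<in> borel_measurable (borel :: ((real^'n) \<times> (nat \<Rightarrow> 'n data)) measure)"
    and [measurable]: "z \<in> borel_measurable N" and [measurable]: "x \<in> borel_measurable N"
  shows "(\<lambda>\<omega>. (H (z \<omega>, x \<omega>) :: nat \<Rightarrow> real^'n) i) \<in> borel_measurable N"
proof -
  have "(\<lambda>\<omega>. (z \<omega>, x \<omega>)) \<in> borel_measurable N"
    unfolding borel_prod[symmetric] by measurable
  from measurable_compose[OF this H] have "(\<lambda>\<omega>. H (z \<omega>, x \<omega>)) \<in> borel_measurable N" .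
  moreover have "(\<lambda>b :: nat \<Rightarrow> real^'n. b i) \<in> borel_measurable borel"
    by (intro borel_measurable_continuous_onI continuous_intros continuous_on_product_then_coordinatewise)
  ultimately show ?thesis
    by (rule measurable_compose)
qed

end

subsection \<open>Sequences with prescribed block costs\<close>

lemma soc_add: "soc G b (m + i) = soc G b m + (\<Sum>k<i. b (m + k))"
  by (induction i) (auto simp: algebra_simps)

context storage_game
begin

text \<open>The expected cost is a quadratic polynomial in the scaling factor, so its continuity
  needs no limit theorem for integrals.\<close>

lemma exp_agg_cost_scale:
  assumes b: "b \<in> borel_measurable M" and adm: "AE \<omega> in M. admissible G (\<Xi> t \<omega>) (b \<omega>)"
  shows "\<exists>q. \<forall>u. (\<integral>\<omega>. agg_cost (\<Xi> t \<omega>) (u *\<^sub>R b \<omega>) \<partial>M) =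
    (1 - u) * (\<integral>\<omega>. agg_cost (\<Xi> t \<omega>) 0 \<partial>M) + u * (\<integral>\<omega>. agg_cost (\<Xi> t \<omega>) (b \<omega>) \<partial>M) - u * (1 - u) * q"
proof -
  have adm0: "AE \<omega> in M. admissible G (\<Xi> t \<omega>) 0"
    using AE_signal_ok by eventually_elim (simp add: admissible_zero)
  have int0: "integrable M (\<lambda>\<omega>. agg_cost (\<Xi> t \<omega>) 0)"
    using integrable_agg_cost[OF _ adm0] by simp
  have int1: "integrable M (\<lambda>\<omega>. agg_cost (\<Xi> t \<omega>) (b \<omega>))"
    by (rule integrable_agg_cost[OF b adm])
  have scale: "agg_cost (\<Xi> t \<omega>) (u *\<^sub>R b \<omega>) = (1 - u) * agg_cost (\<Xi> t \<omega>) 0 + u * agg_cost (\<Xi> t \<omega>) (b \<omega>)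
      - u * (1 - u) * cost_gap (\<Xi> t \<omega>) (b \<omega>)" for u \<omega>
    using agg_cost_convex_combination[of "\<Xi> t \<omega>" u 0 "b \<omega>"] by simp
  \<comment> \<open>Integrability of \<open>cost_gap\<close> is read off the convexity identity at
    weight 1/2, where all three costs are known to be integrable.\<close>
  have half: "AE \<omega> in M. admissible G (\<Xi> t \<omega>) ((1/2) *\<^sub>R b \<omega>)"
    using adm adm0
  proof eventually_elim
    case (elim \<omega>)
    then show ?case using admissible_convex[OF elim(2,1), of "1/2"] by simp
  qed
  have int2: "integrable M (\<lambda>\<omega>. agg_cost (\<Xi> t \<omega>) ((1/2) *\<^sub>R b \<omega>))"
    by (rule integrable_agg_cost[OF _ half]) (use b in measurable)
  have "cost_gap (\<Xi> t \<omega>) (b \<omega>) =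
      2 * agg_cost (\<Xi> t \<omega>) 0 + 2 * agg_cost (\<Xi> t \<omega>) (b \<omega>) - 4 * agg_cost (\<Xi> t \<omega>) ((1/2) *\<^sub>R b \<omega>)" for \<omega>
    unfolding scale by (simp add: field_simps)
  then have int3: "integrable M (\<lambda>\<omega>. cost_gap (\<Xi> t \<omega>) (b \<omega>))"
    using int0 int1 int2 by simp
  show ?thesis
  proof (intro exI allI)
    fix u
    show "(\<integral>\<omega>. agg_cost (\<Xi> t \<omega>) (u *\<^sub>R b \<omega>) \<partial>M) =
      (1 - u) * (\<integral>\<omega>. agg_cost (\<Xi> t \<omega>) 0 \<partial>M) + u * (\<integral>\<omega>. agg_cost (\<Xi> t \<omega>) (b \<omega>) \<partial>M)
      - u * (1 - u) * (\<integral>\<omega>. cost_gap (\<Xi> t \<omega>) (b \<omega>) \<partial>M)"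
      unfolding scale using int0 int1 int3 by simp
  qed
qed

text \<open>The cheapest continuation of the block from the current state costs at most \<open>E\<close> more than it
  would from the initial state, hence in expectation at most \<open>E\<close> more than the first \<open>T\<close> periods of the
  reference sequence. Scaling it down towards zero raises its cost continuously to that of idle
  batteries, so any intermediate cost \<open>\<kappa>\<close> can be hit exactly.\<close>

lemma block_with_cost:
  assumes E: "\<forall>T s s' x b. block_feasible G T s x b \<longrightarrow> s_lo G \<le> s' \<and> s' \<le> s_hi G \<longrightarrow>
      (\<exists>b'. block_feasible G T s' x b' \<and> block_cost T x b' \<le> block_cost T x b + E)"
    and ref: "feasible M G \<Xi> b"
    and z [measurable]: "z \<in> borel_measurable M" and zr: "AE \<omega> in M. s_lo G \<le> z \<omega> \<and> z \<omega> \<le> s_hi G"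
    and \<kappa>: "(\<Sum>t<T. exp_agg_cost M \<Xi> b t) + E \<le> \<kappa>" "\<kappa> \<le> real T * exp_agg_cost M \<Xi> (\<lambda>_ _. 0) 0"
  shows "\<exists>\<beta>. (\<forall>i. \<beta> i \<in> borel_measurable M) \<and>
    (AE \<omega> in M. block_feasible G T (z \<omega>) (\<lambda>i. X (k + i) \<omega>) (\<lambda>i. \<beta> i \<omega>)) \<and>
    (\<Sum>i<T. \<integral>\<omega>. agg_cost (\<Xi> (k + i) \<omega>) (\<beta> i \<omega>) \<partial>M) = \<kappa>"
proof -
  from block_optimizer obtain H :: "(real^'n) \<times> (nat \<Rightarrow> 'n data) \<Rightarrow> nat \<Rightarrow> real^'n" where
    H: "H \<in> borel_measurable borel" and
    opt: "\<forall>s x b. block_feasible G T s x b \<longrightarrow>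
      block_feasible G T s x (H (s, x)) \<and> block_cost T x (H (s, x)) \<le> block_cost T x b"
    by metis
  define \<eta> where "\<eta> i \<omega> = H (z \<omega>, \<lambda>i. X (k + i) \<omega>) i" for i \<omega>
  \<comment> \<open>From the fixed state \<open>s_init G\<close> the optimal cost is a function of
    the data alone, so the shift invariance of their law applies. From \<open>z\<close>, which may
    depend on the same data, it would not.\<close>
  define \<phi> where "\<phi> x = block_cost T x (H (s_init G, x))" for x
  have s_init: "s_lo G \<le> s_init G" "s_init G \<le> s_hi G"
    using grid by (auto simp: grid_ok_def)
  have \<eta> [measurable]: "\<eta> i \<in> borel_measurable M" for i
    unfolding \<eta>_def by (rule measurable_block_optimizer[OF H z measurable_X_seq])
  have \<phi>: "\<phi> \<in> borel_measurable borel"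
  proof -
    have "(\<lambda>x. H (s_init G, x) i) \<in> borel_measurable borel" for i
      by (rule measurable_block_optimizer[OF H]) auto
    moreover have "(\<lambda>x :: nat \<Rightarrow> 'n data. x i) \<in> borel_measurable borel" for i
      by (intro borel_measurable_continuous_onI continuous_intros continuous_on_product_then_coordinatewise)
    ultimately show ?thesis
      unfolding \<phi>_def block_cost_def by (intro borel_measurable_sum measurable_agg_cost)
  qed
  have zero: "AE \<omega> in M. block_feasible G T (z \<omega>) (\<lambda>i. X (k + i) \<omega>) (\<lambda>_. 0)"
    using AE_signal_ok zr
  proof eventually_elim
    case (elim \<omega>)
    then show ?case by (intro block_feasible_zero) auto
  qed
  then have feas: "AE \<omega> in M. block_feasible G T (z \<omega>) (\<lambda>i. X (k + i) \<omega>) (\<lambda>i. \<eta> i \<omega>)"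
  proof eventually_elim
    case (elim \<omega>)
    then show ?case using opt unfolding \<eta>_def by blast
  qed
  note adm = AE_block_admissible[OF feas]
  have int: "integrable M (\<lambda>\<omega>. agg_cost (\<Xi> (k + i) \<omega>) (\<eta> i \<omega>))" if "i < T" for i
    by (rule integrable_agg_cost[OF \<eta> adm[OF that]])
  have opt0: "AE \<omega> in M. block_feasible G T (s_init G) (\<lambda>i. X (k + i) \<omega>) (H (s_init G, \<lambda>i. X (k + i) \<omega>))" for k
    using AE_signal_ok
  proof eventually_elim
    case (elim \<omega>)
    have "block_feasible G T (s_init G) (\<lambda>i. X (k + i) \<omega>) (\<lambda>_. 0)"
      using elim s_init by (intro block_feasible_zero) auto
    then show ?case using opt by blast
  qed
  have int_\<phi>: "integrable M (\<lambda>\<omega>. \<phi> (\<lambda>i. X (k + i) \<omega>))" for k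
    unfolding \<phi>_def block_cost_X
  proof (intro Bochner_Integration.integrable_sum integrable_agg_cost)
    fix i assume "i \<in> {..<T}"
    then show "AE \<omega> in M. admissible G (\<Xi> (k + i) \<omega>) (H (s_init G, \<lambda>i. X (k + i) \<omega>) i)"
      using AE_block_admissible[OF opt0] by simp
    show "(\<lambda>\<omega>. H (s_init G, \<lambda>i. X (k + i) \<omega>) i) \<in> borel_measurable M"
      by (rule measurable_block_optimizer[OF H _ measurable_X_seq]) simp
  qed
  have "(\<Sum>i<T. \<integral>\<omega>. agg_cost (\<Xi> (k + i) \<omega>) (\<eta> i \<omega>) \<partial>M) = (\<integral>\<omega>. (\<Sum>i<T. agg_cost (\<Xi> (k + i) \<omega>) (\<eta> i \<omega>)) \<partial>M)"
    using int by (intro Bochner_Integration.integral_sum[symmetric]) auto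
  also have "\<dots> \<le> (\<integral>\<omega>. \<phi> (\<lambda>i. X (k + i) \<omega>) + E \<partial>M)"
  proof (rule integral_mono_AE)
    show "integrable M (\<lambda>\<omega>. \<Sum>i<T. agg_cost (\<Xi> (k + i) \<omega>) (\<eta> i \<omega>))"
      using int by (intro Bochner_Integration.integrable_sum) auto
    show "integrable M (\<lambda>\<omega>. \<phi> (\<lambda>i. X (k + i) \<omega>) + E)"
      using int_\<phi>[of k] by simp
    show "AE \<omega> in M. (\<Sum>i<T. agg_cost (\<Xi> (k + i) \<omega>) (\<eta> i \<omega>)) \<le> \<phi> (\<lambda>i. X (k + i) \<omega>) + E"
      using opt0[of k] zr
    proof eventually_elim
      case (elim \<omega>)
      then obtain b' where b': "block_feasible G T (z \<omega>) (\<lambda>i. X (k + i) \<omega>) b'"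
        "block_cost T (\<lambda>i. X (k + i) \<omega>) b' \<le> \<phi> (\<lambda>i. X (k + i) \<omega>) + E"
        using E unfolding \<phi>_def by blast
      then have "block_cost T (\<lambda>i. X (k + i) \<omega>) (\<lambda>i. \<eta> i \<omega>) \<le> block_cost T (\<lambda>i. X (k + i) \<omega>) b'"
        using opt unfolding \<eta>_def by blast
      with b'(2) show ?case
        by (simp add: block_cost_X)
    qed
  qed
  also have "\<dots> = (\<integral>\<omega>. \<phi> (\<lambda>i. X (k + i) \<omega>) \<partial>M) + E"
    using int_\<phi>[of k] by (simp add: prob_space)
  also have "(\<integral>\<omega>. \<phi> (\<lambda>i. X (k + i) \<omega>) \<partial>M) = (\<integral>\<omega>. \<phi> (\<lambda>i. X (0 + i) \<omega>) \<partial>M)"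
    using integral_X_shift[OF \<phi>] by simp
  also have "\<dots> \<le> (\<integral>\<omega>. (\<Sum>t<T. agg_cost (\<Xi> t \<omega>) (b t \<omega>)) \<partial>M)"
  proof (rule integral_mono_AE[OF int_\<phi>])
    show "integrable M (\<lambda>\<omega>. \<Sum>t<T. agg_cost (\<Xi> t \<omega>) (b t \<omega>))"
      using ref by (intro Bochner_Integration.integrable_sum integrable_agg_cost feasible_measurable feasible_admissible)
    have "AE \<omega> in M. \<forall>t. s_lo G \<le> soc G (\<lambda>k. b k \<omega>) t \<and> soc G (\<lambda>k. b k \<omega>) t \<le> s_hi G \<and>
        admissible G (\<Xi> t \<omega>) (b t \<omega>)"
      using ref by (simp add: feasible_def)
    then show "AE \<omega> in M. \<phi> (\<lambda>i. X (0 + i) \<omega>) \<le> (\<Sum>t<T. agg_cost (\<Xi> t \<omega>) (b t \<omega>))"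
      using AE_signal_ok
    proof eventually_elim
      case (elim \<omega>)
      \<comment> \<open>Cut off at \<open>T\<close>, since a block decision must vanish afterwards;
        the cost of the first \<open>T\<close> periods is unaffected.\<close>
      let ?b = "\<lambda>i. if i < T then b i \<omega> else 0"
      have "(\<Sum>k<i. ?b k) = (\<Sum>k<i. b k \<omega>)" if "i \<le> T" for i
        using that by (intro sum.cong) auto
      then have "block_feasible G T (s_init G) (\<lambda>i. X (0 + i) \<omega>) ?b"
        using elim unfolding block_feasible_def soc_eq_sum by auto
      then have "\<phi> (\<lambda>i. X (0 + i) \<omega>) \<le> block_cost T (\<lambda>i. X (0 + i) \<omega>) ?b"
        using opt unfolding \<phi>_def by blast
      then show ?case
        by (simp add: block_cost_def)
    qed
  qed
  also have "\<dots> = (\<Sum>t<T. exp_agg_cost M \<Xi> b t)"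
    unfolding exp_agg_cost_def using ref
    by (intro Bochner_Integration.integral_sum integrable_agg_cost feasible_measurable feasible_admissible)
  finally have cost1: "(\<Sum>i<T. \<integral>\<omega>. agg_cost (\<Xi> (k + i) \<omega>) (\<eta> i \<omega>) \<partial>M) \<le> \<kappa>"
    using \<kappa>(1) by simp
  define g where "g u = (\<Sum>i<T. \<integral>\<omega>. agg_cost (\<Xi> (k + i) \<omega>) (u *\<^sub>R \<eta> i \<omega>) \<partial>M)" for u
  have "\<exists>u\<ge>0. u \<le> 1 \<and> g u = \<kappa>"
  proof (rule IVT2')
    show "g 1 \<le> \<kappa>" using cost1 by (simp add: g_def)
    show "\<kappa> \<le> g 0"
      using \<kappa>(2) exp_agg_cost_zero[of "k + i" for i] by (simp add: g_def exp_agg_cost_def)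
    show "continuous_on {0..1} g"
      unfolding g_def
    proof (rule continuous_on_sum)
      fix i assume "i \<in> {..<T}"
      then obtain q where q: "\<forall>u. (\<integral>\<omega>. agg_cost (\<Xi> (k + i) \<omega>) (u *\<^sub>R \<eta> i \<omega>) \<partial>M) =
          (1 - u) * (\<integral>\<omega>. agg_cost (\<Xi> (k + i) \<omega>) 0 \<partial>M) + u * (\<integral>\<omega>. agg_cost (\<Xi> (k + i) \<omega>) (\<eta> i \<omega>) \<partial>M)
          - u * (1 - u) * q"
        using exp_agg_cost_scale[OF \<eta> adm] by blast
      show "continuous_on {0..1} (\<lambda>u. \<integral>\<omega>. agg_cost (\<Xi> (k + i) \<omega>) (u *\<^sub>R \<eta> i \<omega>) \<partial>M)"
        unfolding q[rule_format] by (intro continuous_intros)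
    qed
  qed simp
  then obtain u where u: "0 \<le> u" "u \<le> 1" "g u = \<kappa>"
    by blast
  have "AE \<omega> in M. block_feasible G T (z \<omega>) (\<lambda>i. X (k + i) \<omega>) (\<lambda>i. u *\<^sub>R \<eta> i \<omega>)"
    using feas zero
  proof eventually_elim
    case (elim \<omega>)
    then show ?case using block_feasible_convex[OF elim(2,1) u(1,2)] by simp
  qed
  moreover have "(\<lambda>\<omega>. u *\<^sub>R \<eta> i \<omega>) \<in> borel_measurable M" for i
    by measurable
  ultimately show ?thesis
    using u(3) unfolding g_def by (intro exI[of _ "\<lambda>i \<omega>. u *\<^sub>R \<eta> i \<omega>"]) simp
qed

text \<open>Blocks are chained through their final states. These are random, which is why
  \<open>step\<close> is required for every measurable initial state within the limits.\<close>

lemma feasible_with_block_costs: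
  assumes T: "0 < T"
    and step: "\<And>k z. z \<in> borel_measurable M \<Longrightarrow> AE \<omega> in M. s_lo G \<le> z \<omega> \<and> z \<omega> \<le> s_hi G \<Longrightarrow>
    \<exists>\<beta>. (\<forall>i. \<beta> i \<in> borel_measurable M) \<and>
    (AE \<omega> in M. block_feasible G T (z \<omega>) (\<lambda>i. X (k + i) \<omega>) (\<lambda>i. \<beta> i \<omega>)) \<and>
    (\<Sum>i<T. \<integral>\<omega>. agg_cost (\<Xi> (k + i) \<omega>) (\<beta> i \<omega>) \<partial>M) = \<kappa>"
  shows "\<exists>b. feasible M G \<Xi> b \<and> (\<forall>j. (\<Sum>i<T. exp_agg_cost M \<Xi> b (j * T + i)) = \<kappa>)"
proof -
  define good where "good k z \<beta> \<longleftrightarrow> (\<forall>i. \<beta> i \<in> borel_measurable M) \<and>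
    (AE \<omega> in M. block_feasible G T (z \<omega>) (\<lambda>i. X (k + i) \<omega>) (\<lambda>i. \<beta> i \<omega>)) \<and>
    (\<Sum>i<T. \<integral>\<omega>. agg_cost (\<Xi> (k + i) \<omega>) (\<beta> i \<omega>) \<partial>M) = \<kappa>" for k z and \<beta> :: "nat \<Rightarrow> 'w \<Rightarrow> real^'n"
  \<comment> \<open>The choice is made among whole families of random variables, so measurability is
    part of what is chosen; a separate choice at each \<open>\<omega>\<close> would lose it.\<close>
  define B where "B j z = (SOME \<beta>. good (j * T) z \<beta>)" for j z
  define Z where "Z = rec_nat (\<lambda>_. s_init G) (\<lambda>j z \<omega>. z \<omega> + (\<Sum>i<T. B j z i \<omega>))"
  have Z0: "Z 0 = (\<lambda>_. s_init G)" and ZS: "Z (Suc j) = (\<lambda>\<omega>. Z j \<omega> + (\<Sum>i<T. B j (Z j) i \<omega>))" for j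
    by (simp_all add: Z_def)
  have s_init: "s_lo G \<le> s_init G" "s_init G \<le> s_hi G"
    using grid by (auto simp: grid_ok_def)
  have Bgood: "good (j * T) (Z j) (B j (Z j))"
    if "Z j \<in> borel_measurable M" "AE \<omega> in M. s_lo G \<le> Z j \<omega> \<and> Z j \<omega> \<le> s_hi G" for j
  proof -
    have "\<exists>\<beta>. good (j * T) (Z j) \<beta>"
      unfolding good_def by (rule step[OF that])
    then show ?thesis
      unfolding B_def by (rule someI_ex)
  qed
  have Zgood: "Z j \<in> borel_measurable M \<and> (AE \<omega> in M. s_lo G \<le> Z j \<omega> \<and> Z j \<omega> \<le> s_hi G)" for j
  proof (induction j)
    case 0
    then show ?case using s_init by (simp add: Z0)
  next
    case (Suc j)
    note g = Bgood[OF conjunct1[OF Suc] conjunct2[OF Suc], unfolded good_def]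
    have "AE \<omega> in M. s_lo G \<le> Z (Suc j) \<omega> \<and> Z (Suc j) \<omega> \<le> s_hi G"
      using g[THEN conjunct2, THEN conjunct1]
      unfolding ZS by eventually_elim (rule block_feasible_soc)
    moreover have "Z (Suc j) \<in> borel_measurable M"
      unfolding ZS using Suc g by (intro borel_measurable_add borel_measurable_sum) auto
    ultimately show ?case by blast
  qed
  define b where "b t \<omega> = B (t div T) (Z (t div T)) (t mod T) \<omega>" for t \<omega>
  have B: "good (j * T) (Z j) (B j (Z j))" for j
    using Bgood Zgood by blast
  have b_eq: "b (j * T + i) \<omega> = B j (Z j) i \<omega>" if "i < T" for j i \<omega>
    using that by (simp add: b_def)
  have Z_soc: "soc G (\<lambda>k. b k \<omega>) (j * T) = Z j \<omega>" for j \<omega>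
  proof (induction j)
    case (Suc j)
    have "soc G (\<lambda>k. b k \<omega>) (j * T + T) = Z j \<omega> + (\<Sum>i<T. b (j * T + i) \<omega>)"
      unfolding soc_add Suc ..
    also have "\<dots> = Z (Suc j) \<omega>"
      by (simp add: ZS b_eq)
    finally show ?case
      by (simp add: add.commute)
  qed (simp add: Z0)
  have "feasible M G \<Xi> b"
    unfolding feasible_def
  proof (intro conjI allI)
    show "b t \<in> borel_measurable M" for t
      using B[of "t div T"] unfolding b_def good_def by blast
    have "AE \<omega> in M. \<forall>j. block_feasible G T (Z j \<omega>) (\<lambda>i. X (j * T + i) \<omega>) (\<lambda>i. B j (Z j) i \<omega>)"
      using B unfolding good_def by (simp add: AE_all_countable)
    then show "AE \<omega> in M. \<forall>t. s_lo G \<le> soc G (\<lambda>k. b k \<omega>) t \<and> soc G (\<lambda>k. b k \<omega>) t \<le> s_hi G \<and>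
        admissible G (\<Xi> t \<omega>) (b t \<omega>)"
    proof eventually_elim
      case (elim \<omega>)
      show ?case
      proof
        fix t
        define j i where "j = t div T" and "i = t mod T"
        have t: "t = j * T + i" and i: "i < T"
          using T by (simp_all add: j_def i_def)
        have "(\<Sum>k<i. b (j * T + k) \<omega>) = (\<Sum>k<i. B j (Z j) k \<omega>)"
          using i by (intro sum.cong) (auto simp: b_eq)
        then have "soc G (\<lambda>k. b k \<omega>) t = Z j \<omega> + (\<Sum>k<i. B j (Z j) k \<omega>)"
          unfolding t soc_add Z_soc by simp
        moreover have bf: "block_feasible G T (Z j \<omega>) (\<lambda>i. X (j * T + i) \<omega>) (\<lambda>i. B j (Z j) i \<omega>)"
          using elim by blast
        moreover have "admissible G (\<Xi> t \<omega>) (b t \<omega>)"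
          using bf i unfolding block_feasible_def t b_eq[OF i] by auto
        ultimately show "s_lo G \<le> soc G (\<lambda>k. b k \<omega>) t \<and> soc G (\<lambda>k. b k \<omega>) t \<le> s_hi G \<and>
            admissible G (\<Xi> t \<omega>) (b t \<omega>)"
          using block_feasible_soc[OF bf, of i] by simp
      qed
    qed
  qed
  moreover have "(\<Sum>i<T. exp_agg_cost M \<Xi> b (j * T + i)) = \<kappa>" for j
    using B[of j] unfolding good_def exp_agg_cost_def by (simp add: b_eq)
  ultimately show ?thesis by blast
qed

end

text \<open>After subtraction of \<open>\<nu>\<close> complete blocks cancel, and fewer than
  \<open>T\<close> bounded terms remain to be divided by the horizon.\<close>

lemma time_avg_of_block_sums:
  assumes T: "0 < T" and bd: "\<And>t. \<bar>x t\<bar> \<le> C"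
    and blocks: "\<And>j. (\<Sum>i<T. x (j * T + i)) = real T * \<nu>"
  shows "time_avg x \<longlonglongrightarrow> \<nu>"
proof -
  define y where "y t = x t - \<nu>" for t
  have y0: "(\<Sum>i<T. y (j * T + i)) = 0" for j
    unfolding y_def sum_subtractf blocks by simp
  have sum_y: "(\<Sum>t<j * T + i. y t) = (\<Sum>k<i. y (j * T + k))" for j i
  proof (induction j arbitrary: i)
    case (Suc j)
    have "(\<Sum>t<j * T + (T + i). y t) = (\<Sum>k<T + i. y (j * T + k))"
      by (rule Suc)
    also have "\<dots> = (\<Sum>k<T. y (j * T + k)) + (\<Sum>k<i. y (j * T + (T + k)))"
      by (induction i) (auto simp: algebra_simps)
    finally show ?case
      unfolding y0 by (simp add: ac_simps)
  qed simp
  let ?D = "real T * (C + \<bar>\<nu>\<bar>)"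
  have y_le: "\<bar>y t\<bar> \<le> C + \<bar>\<nu>\<bar>" for t
    unfolding y_def using bd[of t] by linarith
  have bound: "\<bar>time_avg x N - \<nu>\<bar> \<le> ?D / real N" if "0 < N" for N
  proof -
    have "\<bar>\<Sum>k<N mod T. y (N div T * T + k)\<bar> \<le> (\<Sum>k<N mod T. C + \<bar>\<nu>\<bar>)"
      by (rule order_trans[OF sum_abs sum_mono[OF y_le]])
    also have "\<dots> \<le> ?D"
      using T bd[of 0] by (auto intro!: mult_right_mono)
    finally have "\<bar>\<Sum>t<N. y t\<bar> \<le> ?D"
      using sum_y[where j = "N div T" and i = "N mod T"] by simp
    moreover have "time_avg x N - \<nu> = (\<Sum>t<N. y t) / real N"
      using that by (simp add: time_avg_def y_def sum_subtractf field_simps)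
    ultimately show ?thesis
      by (simp add: abs_divide divide_right_mono)
  qed
  have "(\<lambda>N. time_avg x N - \<nu>) \<longlonglongrightarrow> 0"
  proof (rule Lim_null_comparison)
    show "\<forall>\<^sub>F N in sequentially. norm (time_avg x N - \<nu>) \<le> ?D / real N"
      using eventually_gt_at_top[of 0] by eventually_elim (use bound in auto)
    show "(\<lambda>N. ?D / real N) \<longlonglongrightarrow> 0"
      by (rule lim_const_over_n)
  qed
  then show ?thesis
    using LIM_zero_cancel by blast
qed

context storage_game
begin

lemma feasible_zero: "feasible M G \<Xi> (\<lambda>_ _. 0)"
proof -
  have s_init: "s_lo G \<le> s_init G" "s_init G \<le> s_hi G"
    using grid by (auto simp: grid_ok_def)
  have "AE \<omega> in M. \<forall>t. admissible G (\<Xi> t \<omega>) 0"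
    using AE_signal_ok by eventually_elim (simp add: admissible_zero)
  then show ?thesis
    using s_init by (simp add: feasible_def soc_eq_sum)
qed

lemma offline_value_le_time_avg:
  assumes opt: "offline_minimizer M G \<Xi> b_opt" and b: "feasible M G \<Xi> b"
    and \<mu>: "\<mu> < lim (time_avg (exp_agg_cost M \<Xi> b_opt))" (is "\<mu> < ?V")
  shows "\<forall>\<^sub>F T in sequentially. \<mu> \<le> time_avg (exp_agg_cost M \<Xi> b) T"
proof (rule ccontr)
  assume "\<not> ?thesis"
  then have freq: "\<exists>\<^sub>F T in sequentially. time_avg (exp_agg_cost M \<Xi> b) T < \<mu>"
    by (simp add: frequently_def not_less)
  have V_le: "?V \<le> lim (time_avg (exp_agg_cost M \<Xi> b'))"
    if "feasible M G \<Xi> b'" "convergent (time_avg (exp_agg_cost M \<Xi> b'))" for b'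
    using opt that unfolding offline_minimizer_def is_arg_min_def by (metis not_less)
  obtain C where C: "\<forall>t b. b t \<in> borel_measurable M \<longrightarrow> (AE \<omega> in M. admissible G (\<Xi> t \<omega>) (b t \<omega>)) \<longrightarrow>
      \<bar>exp_agg_cost M \<Xi> b t\<bar> \<le> C"
    using exp_agg_cost_bounded by blast
  have bd: "\<bar>exp_agg_cost M \<Xi> b' t\<bar> \<le> C" if "feasible M G \<Xi> b'" for b' t
    using C feasible_measurable[OF that] feasible_admissible[OF that] by blast
  \<comment> \<open>Scaling charges down reaches no cost above that guaranteed by idling, so the
    target must not exceed the idle cost. Idling has a convergent average and is itself a
    competitor, hence \<open>?V \<le> ?v0\<close>.\<close>
  let ?v0 = "exp_agg_cost M \<Xi> (\<lambda>_ _. 0) 0"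
  have "time_avg (exp_agg_cost M \<Xi> (\<lambda>_ _. 0)) \<longlonglongrightarrow> ?v0"
    using exp_agg_cost_zero bd[OF feasible_zero] by (intro time_avg_of_block_sums[of 1]) auto
  then have v0: "?V \<le> ?v0"
    using V_le[OF feasible_zero] by (metis convergentI limI)
  obtain E where E: "\<forall>T s s' x b. block_feasible G T s x b \<longrightarrow> s_lo G \<le> s' \<and> s' \<le> s_hi G \<longrightarrow>
      (\<exists>b'. block_feasible G T s' x b' \<and> block_cost T x b' \<le> block_cost T x b + E)"
    using block_switch_cost by blast
  \<comment> \<open>The target average lies strictly between the two values: below \<open>?V\<close>
    for the contradiction, and above \<open>\<mu>\<close> so that \<open>T * (\<nu> - \<mu>)\<close>
    can pay for the switching cost \<open>E\<close> once \<open>T\<close> is large.\<close>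
  define \<nu> where "\<nu> = (\<mu> + ?V) / 2"
  have "\<forall>\<^sub>F T in sequentially. E / (\<nu> - \<mu>) < real T \<and> 0 < T"
    by (intro eventually_conj eventually_gt_at_top filterlim_real_sequentially[THEN filterlim_at_top_dense[THEN iffD1], rule_format])
  from frequently_eventually_frequently[OF freq this]
  obtain T where T: "time_avg (exp_agg_cost M \<Xi> b) T < \<mu>" "E / (\<nu> - \<mu>) < real T" "0 < T"
    using frequently_ex by blast
  have "\<mu> < \<nu>" "\<nu> < ?V"
    using \<mu> by (auto simp: \<nu>_def)
  have "(\<Sum>t<T. exp_agg_cost M \<Xi> b t) < real T * \<mu>"
    using T by (simp add: time_avg_def field_simps)
  moreover have "E < real T * (\<nu> - \<mu>)"
    using T(2) \<open>\<mu> < \<nu>\<close> by (simp add: field_simps)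
  ultimately have lower: "(\<Sum>t<T. exp_agg_cost M \<Xi> b t) + E \<le> real T * \<nu>"
    by (simp add: algebra_simps)
  have upper: "real T * \<nu> \<le> real T * ?v0"
    using \<open>\<nu> < ?V\<close> v0 by (intro mult_left_mono) auto
  obtain b' where b': "feasible M G \<Xi> b'" "\<forall>j. (\<Sum>i<T. exp_agg_cost M \<Xi> b' (j * T + i)) = real T * \<nu>"
    using feasible_with_block_costs[OF \<open>0 < T\<close> block_with_cost[OF E b _ _ lower upper]] by blast
  have "time_avg (exp_agg_cost M \<Xi> b') \<longlonglongrightarrow> \<nu>"
    using b'(2) by (intro time_avg_of_block_sums[OF \<open>0 < T\<close> bd[OF b'(1)]]) auto
  then have "?V \<le> \<nu>"
    using V_le[OF b'(1)] by (metis convergentI limI)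
  then show False
    using \<open>\<nu> < ?V\<close> by simp
qed

end

subsection \<open>Cost of the real-time decisions\<close>

text \<open>Fubini on the product law: a bound that holds with the first variable frozen at every
  value survives averaging over that variable.\<close>

lemma (in prob_space) indep_var_expectation_le:
  fixes m :: "'b \<times> 'b \<Rightarrow> real"
  assumes ind: "indep_var N1 U N2 W" and m [measurable]: "m \<in> borel_measurable (N1 \<Otimes>\<^sub>M N2)"
    and int: "integrable M (\<lambda>\<omega>. m (U \<omega>, W \<omega>))"
    and le: "\<And>u. (\<integral>\<omega>. m (u, W \<omega>) \<partial>M) \<le> c"
  shows "(\<integral>\<omega>. m (U \<omega>, W \<omega>) \<partial>M) \<le> c"
proof -
  have U [measurable]: "U \<in> measurable M N1" and W [measurable]: "W \<in> measurable M N2"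
    and joint: "distr M N1 U \<Otimes>\<^sub>M distr M N2 W = distr M (N1 \<Otimes>\<^sub>M N2) (\<lambda>\<omega>. (U \<omega>, W \<omega>))"
    using ind by (auto simp: indep_var_distribution_eq)
  interpret U: prob_space "distr M N1 U" by (rule prob_space_distr) measurable
  interpret W: prob_space "distr M N2 W" by (rule prob_space_distr) measurable
  interpret UW: pair_prob_space "distr M N1 U" "distr M N2 W" ..
  have pair: "(\<lambda>\<omega>. (U \<omega>, W \<omega>)) \<in> measurable M (N1 \<Otimes>\<^sub>M N2)"
    by measurable
  have int': "integrable (distr M N1 U \<Otimes>\<^sub>M distr M N2 W) m"
    unfolding joint using int integrable_distr_eq[OF pair m] by simp
  have "(\<integral>\<omega>. m (U \<omega>, W \<omega>) \<partial>M) = (\<integral>p. m p \<partial>(distr M N1 U \<Otimes>\<^sub>M distr M N2 W))"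
    unfolding joint by (rule integral_distr[OF pair m, symmetric])
  also have "\<dots> = (\<integral>u. (\<integral>v. m (u, v) \<partial>distr M N2 W) \<partial>distr M N1 U)"
    by (rule UW.integral_fst'[OF int', symmetric])
  also have "\<dots> \<le> c"
  proof (rule U.integral_le_const[OF UW.integrable_fst'[OF int']])
    show "AE u in distr M N1 U. (\<integral>v. m (u, v) \<partial>distr M N2 W) \<le> c"
    proof (rule AE_I2)
      fix u assume "u \<in> space (distr M N1 U)"
      then have "(\<lambda>v. m (u, v)) \<in> borel_measurable N2"
        by (intro measurable_compose[OF measurable_Pair1' m]) simp
      from integral_distr[OF W this] show "(\<integral>v. m (u, v) \<partial>distr M N2 W) \<le> c"
        using le[of u] by simp
    qed
  qed
  finally show ?thesis .
qed

lemma bounded_interval_vec: "\<exists>R\<ge>0. \<forall>v::real^'n::finite. lo \<le> v \<and> v \<le> hi \<longrightarrow> norm v \<le> R"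
proof -
  obtain R where R: "\<forall>v\<in>cbox lo hi. norm v \<le> R"
    using bounded_cbox[of lo hi] unfolding bounded_iff by blast
  then show ?thesis
    by (intro exI[of _ "\<bar>R\<bar>"]) (force simp: interval_cbox_cart[symmetric])
qed

context storage_game
begin

lemma integrable_inner_admissible:
  assumes y [measurable]: "y \<in> borel_measurable M" and yR: "AE \<omega> in M. norm (y \<omega>) \<le> R"
    and b [measurable]: "b \<in> borel_measurable M" and adm: "AE \<omega> in M. admissible G (\<Xi> t \<omega>) (b \<omega>)"
  shows "integrable M (\<lambda>\<omega>. y \<omega> \<bullet> b \<omega>)"
proof -
  obtain R' where R': "0 \<le> R'" "\<forall>v. b_lo G \<le> v \<and> v \<le> b_hi G \<longrightarrow> norm v \<le> R'"
    using bounded_interval_vec by blast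
  have "AE \<omega> in M. norm (y \<omega> \<bullet> b \<omega>) \<le> R * R'"
    using yR adm
  proof eventually_elim
    case (elim \<omega>)
    have "norm (y \<omega> \<bullet> b \<omega>) \<le> norm (y \<omega>) * norm (b \<omega>)"
      by (simp add: Cauchy_Schwarz_ineq2)
    also have "\<dots> \<le> R * R'"
      using elim R' by (intro mult_mono) (auto simp: admissible_def intro: order_trans[OF norm_ge_zero])
    finally show ?case .
  qed
  then show ?thesis
    by (rule integrable_const_bound) measurable
qed

text \<open>The charges of a feasible sequence average to zero over the long run, so the multiplier \<open>y\<close> does
  not change its cost.\<close>

lemma weak_duality:
  assumes b: "feasible M G \<Xi> b" and V: "time_avg (exp_agg_cost M \<Xi> b) \<longlonglongrightarrow> V"
    and \<phi> [measurable]: "\<phi> \<in> borel_measurable borel" and int_\<phi>: "\<And>t. integrable M (\<lambda>\<omega>. \<phi> (X t \<omega>))"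
    and le: "\<And>t \<omega> c. signal_ok G (\<Xi> t \<omega>) \<Longrightarrow> admissible G (\<Xi> t \<omega>) c \<Longrightarrow>
      \<phi> (X t \<omega>) \<le> y \<bullet> c + agg_cost (\<Xi> t \<omega>) c"
  shows "(\<integral>\<omega>. \<phi> (X t \<omega>) \<partial>M) \<le> V"
proof -
  have law: "(\<integral>\<omega>. \<phi> (X t \<omega>) \<partial>M) = (\<integral>\<omega>. \<phi> (X 0 \<omega>) \<partial>M)" for t
  proof -
    have "(\<integral>\<omega>. \<phi> (X t \<omega>) \<partial>M) = (\<integral>x. \<phi> x \<partial>distr M borel (X t))" for t
      by (rule integral_distr[symmetric]) measurable
    from this[of t] this[of 0] show ?thesis
      by (simp add: distr_X[of t])
  qed
  let ?\<theta> = "\<integral>\<omega>. \<phi> (X 0 \<omega>) \<partial>M"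
  obtain R where R: "0 \<le> R" "\<forall>v. s_lo G \<le> v \<and> v \<le> s_hi G \<longrightarrow> norm v \<le> R"
    using bounded_interval_vec by blast
  have s_init: "norm (s_init G) \<le> R"
    using R grid by (auto simp: grid_ok_def)
  note b_meas = feasible_measurable[OF b] and b_adm = feasible_admissible[OF b]
  have int_y: "integrable M (\<lambda>\<omega>. y \<bullet> b t \<omega>)" for t
    by (rule integrable_inner_admissible[OF _ _ b_meas b_adm, of "\<lambda>_. y" "norm y"]) auto
  have int_f: "integrable M (\<lambda>\<omega>. agg_cost (\<Xi> t \<omega>) (b t \<omega>))" for t
    by (rule integrable_agg_cost[OF b_meas b_adm])
  \<comment> \<open>The hypothesis \<open>le\<close> is pathwise, so it applies to \<open>b\<close>
    even though its decisions may depend on future data.\<close>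
  have step: "?\<theta> \<le> (\<integral>\<omega>. y \<bullet> b t \<omega> \<partial>M) + exp_agg_cost M \<Xi> b t" for t
  proof -
    have "(\<integral>\<omega>. \<phi> (X t \<omega>) \<partial>M) \<le> (\<integral>\<omega>. y \<bullet> b t \<omega> + agg_cost (\<Xi> t \<omega>) (b t \<omega>) \<partial>M)"
    proof (rule integral_mono_AE[OF int_\<phi>])
      show "AE \<omega> in M. \<phi> (X t \<omega>) \<le> y \<bullet> b t \<omega> + agg_cost (\<Xi> t \<omega>) (b t \<omega>)"
        using AE_signal_ok b_adm[of t] by eventually_elim (use le in blast)
    qed (use int_y int_f in auto)
    then show ?thesis
      using int_y int_f by (simp add: law[of t] exp_agg_cost_def)
  qed
  have drift: "(\<Sum>t<T. \<integral>\<omega>. y \<bullet> b t \<omega> \<partial>M) \<le> norm y * (2 * R)" for T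
  proof -
    have "(\<Sum>t<T. \<integral>\<omega>. y \<bullet> b t \<omega> \<partial>M) = (\<integral>\<omega>. (\<Sum>t<T. y \<bullet> b t \<omega>) \<partial>M)"
      using int_y by (intro Bochner_Integration.integral_sum[symmetric]) auto
    also have "\<dots> \<le> norm y * (2 * R)"
    proof (rule integral_le_const)
      show "integrable M (\<lambda>\<omega>. \<Sum>t<T. y \<bullet> b t \<omega>)"
        using int_y by auto
      have "AE \<omega> in M. \<forall>t. s_lo G \<le> soc G (\<lambda>k. b k \<omega>) t \<and> soc G (\<lambda>k. b k \<omega>) t \<le> s_hi G \<and>
          admissible G (\<Xi> t \<omega>) (b t \<omega>)"
        using b by (simp add: feasible_def)
      then show "AE \<omega> in M. (\<Sum>t<T. y \<bullet> b t \<omega>) \<le> norm y * (2 * R)"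
      proof eventually_elim
        case (elim \<omega>)
        have "norm (soc G (\<lambda>k. b k \<omega>) T) \<le> R"
          using elim R by blast
        then have "norm (soc G (\<lambda>k. b k \<omega>) T - s_init G) \<le> 2 * R"
          using s_init norm_triangle_ineq4[of "soc G (\<lambda>k. b k \<omega>) T" "s_init G"] by linarith
        moreover have "(\<Sum>t<T. y \<bullet> b t \<omega>) = y \<bullet> (soc G (\<lambda>k. b k \<omega>) T - s_init G)"
          by (simp add: soc_eq_sum inner_sum_right)
        moreover have "\<dots> \<le> norm y * norm (soc G (\<lambda>k. b k \<omega>) T - s_init G)"
          by (rule norm_cauchy_schwarz)
        moreover have "\<dots> \<le> norm y * (2 * R)"
          using calculation(1) by (intro mult_left_mono) auto
        ultimately show ?case by linarith
      qed
    qed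
    finally show ?thesis .
  qed
  have avg: "?\<theta> \<le> norm y * (2 * R) / real T + time_avg (exp_agg_cost M \<Xi> b) T" if "0 < T" for T
  proof -
    have "real T * ?\<theta> = (\<Sum>t<T. ?\<theta>)"
      by simp
    also have "\<dots> \<le> (\<Sum>t<T. (\<integral>\<omega>. y \<bullet> b t \<omega> \<partial>M) + exp_agg_cost M \<Xi> b t)"
      by (rule sum_mono[OF step])
    also have "\<dots> \<le> norm y * (2 * R) + (\<Sum>t<T. exp_agg_cost M \<Xi> b t)"
      unfolding sum.distrib using drift[of T] by simp
    finally show ?thesis
      using that by (simp add: time_avg_def field_simps)
  qed
  have "(\<lambda>T. norm y * (2 * R) / real T + time_avg (exp_agg_cost M \<Xi> b) T) \<longlonglongrightarrow> 0 + V"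
    by (intro tendsto_add V lim_const_over_n)
  then have "?\<theta> \<le> 0 + V"
    by (rule LIMSEQ_le_const) (use avg in \<open>auto intro: exI[of _ 1]\<close>)
  then show ?thesis
    by (simp add: law[of t])
qed

end

text \<open>The gradient, in the state of charge, of half the weighted sum of squared virtual
  queues; it plays the role of the multiplier.\<close>

definition queue_weight :: "real^'n \<Rightarrow> real^'n \<Rightarrow> real^'n \<Rightarrow> real^'n::finite" where
  "queue_weight w \<gamma> s = (\<chi> n. w $ n * (s $ n + \<gamma> $ n))"

lemma continuous_on_queue_weight: "continuous_on S (queue_weight w \<gamma>)"
  unfolding queue_weight_def by (intro continuous_intros)

lemma queue_weight_inner: "queue_weight w \<gamma> s \<bullet> y = (\<Sum>n\<in>UNIV. w $ n * (s $ n + \<gamma> $ n) * y $ n)"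
  by (simp add: queue_weight_def inner_vec_def)

context storage_game
begin

text \<open>The state of charge under the real-time decisions is a function of past data only, hence
  independent of the current data.\<close>

lemma real_time_cost_le:
  assumes rt: "real_time_decisions M G \<Xi> w \<gamma> b" and feas: "feasible M G \<Xi> b"
    and ref: "feasible M G \<Xi> b_ref" and V: "time_avg (exp_agg_cost M \<Xi> b_ref) \<longlonglongrightarrow> V"
  shows "integrable M (\<lambda>\<omega>. queue_weight w \<gamma> (soc G (\<lambda>k. b k \<omega>) t) \<bullet> b t \<omega>)" (is ?int)
    and "(\<integral>\<omega>. queue_weight w \<gamma> (soc G (\<lambda>k. b k \<omega>) t) \<bullet> b t \<omega> \<partial>M) + exp_agg_cost M \<Xi> b t \<le> V" (is ?le)
proof -
  from one_period_optimizer obtain h :: "(real^'n) \<times> 'n data \<Rightarrow> real^'n" where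
    h: "h \<in> borel_measurable borel" and
    opt: "\<forall>y x b. signal_ok G (sig_of x) \<longrightarrow> admissible G (sig_of x) b \<longrightarrow>
      admissible G (sig_of x) (h (y, x)) \<and>
      y \<bullet> h (y, x) + agg_cost (sig_of x) (h (y, x)) \<le> y \<bullet> b + agg_cost (sig_of x) b \<and>
      (y \<bullet> b + agg_cost (sig_of x) b \<le> y \<bullet> h (y, x) + agg_cost (sig_of x) (h (y, x)) \<longrightarrow> b = h (y, x))"
    by metis
  note b_meas = feasible_measurable[OF feas] and b_adm = feasible_admissible[OF feas]
  have h_pair: "h \<in> borel_measurable (borel \<Otimes>\<^sub>M borel)"
    using h by (simp add: borel_prod)
  let ?Y = "\<lambda>t \<omega>. queue_weight w \<gamma> (soc G (\<lambda>k. b k \<omega>) t)"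
  have Y_borel [measurable]: "queue_weight w \<gamma> \<in> borel_measurable borel"
    by (intro borel_measurable_continuous_onI continuous_on_queue_weight)
  have soc_meas [measurable]: "(\<lambda>\<omega>. soc G (\<lambda>k. b k \<omega>) t) \<in> borel_measurable M" for t
    unfolding soc_eq_sum using b_meas by (intro borel_measurable_add borel_measurable_sum) auto
  have Y_meas: "?Y t \<in> borel_measurable M" for t
    by measurable
  have "compact (queue_weight w \<gamma> ` cbox (s_lo G) (s_hi G))"
    by (intro compact_continuous_image continuous_on_queue_weight compact_cbox)
  from compact_imp_bounded[OF this, unfolded bounded_iff]
  obtain R where R: "\<forall>v\<in>queue_weight w \<gamma> ` cbox (s_lo G) (s_hi G). norm v \<le> R" ..
  have Y_bound: "AE \<omega> in M. norm (?Y t \<omega>) \<le> R" for t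
  proof -
    have "AE \<omega> in M. \<forall>t. s_lo G \<le> soc G (\<lambda>k. b k \<omega>) t \<and> soc G (\<lambda>k. b k \<omega>) t \<le> s_hi G \<and>
        admissible G (\<Xi> t \<omega>) (b t \<omega>)"
      using feas by (simp add: feasible_def)
    then show ?thesis
      by eventually_elim (use R in \<open>auto simp: interval_cbox_cart[symmetric]\<close>)
  qed
  show ?int
    by (rule integrable_inner_admissible[OF Y_meas Y_bound b_meas b_adm])
  have "AE \<omega> in M. \<forall>t. is_arg_min (\<lambda>y. ?Y t \<omega> \<bullet> y + agg_cost (\<Xi> t \<omega>) y) (admissible G (\<Xi> t \<omega>)) (b t \<omega>)"
    using rt by (simp add: real_time_decisions_def queue_weight_inner)
  then have b_eq: "AE \<omega> in M. \<forall>t. b t \<omega> = h (?Y t \<omega>, X t \<omega>)"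
    using AE_signal_ok
  proof eventually_elim
    case (elim \<omega>)
    show ?case
    proof
      fix t
      have ok: "signal_ok G (sig_of (X t \<omega>))" and adm: "admissible G (sig_of (X t \<omega>)) (b t \<omega>)"
        using elim by (auto simp: is_arg_min_def)
      then have adm_h: "admissible G (sig_of (X t \<omega>)) (h (?Y t \<omega>, X t \<omega>))"
        using opt by blast
      have "?Y t \<omega> \<bullet> b t \<omega> + agg_cost (sig_of (X t \<omega>)) (b t \<omega>) \<le>
          ?Y t \<omega> \<bullet> h (?Y t \<omega>, X t \<omega>) + agg_cost (sig_of (X t \<omega>)) (h (?Y t \<omega>, X t \<omega>))"
        using elim(1) adm_h unfolding is_arg_min_def by (auto simp: not_less)
      then show "b t \<omega> = h (?Y t \<omega>, X t \<omega>)"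
        using opt ok adm by blast
    qed
  qed
  \<comment> \<open>Replays the state of charge from a data sequence by iterating the one-period
    optimizer.\<close>
  define S where "S = rec_nat (\<lambda>_. s_init G) (\<lambda>t s x. s x + h (queue_weight w \<gamma> (s x), x t))"
  have S0: "S 0 = (\<lambda>_. s_init G)" and SS: "S (Suc t) = (\<lambda>x. S t x + h (queue_weight w \<gamma> (S t x), x t))" for t
    by (simp_all add: S_def)
  \<comment> \<open>Only the first \<open>t\<close> entries are read. This makes \<open>S t\<close>
    a function on the product space over past periods, whose elements carry no information
    elsewhere.\<close>
  have S_restrict: "S t (restrict x {..<t'}) = S t x" if "t \<le> t'" for t t' x
    using that by (induction t) (auto simp: S0 SS)
  have S_meas: "S t \<in> borel_measurable (\<Pi>\<^sub>M i\<in>{..<t}. borel)" for t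
  proof (induction t)
    case (Suc t)
    have "(\<lambda>x. S t (restrict x {..<t})) \<in> borel_measurable (\<Pi>\<^sub>M i\<in>{..<Suc t}. borel)"
      by (rule measurable_compose[OF measurable_restrict_subset Suc]) auto
    then have [measurable]: "S t \<in> borel_measurable (\<Pi>\<^sub>M i\<in>{..<Suc t}. borel)"
      by (simp add: S_restrict)
    have [measurable]: "(\<lambda>x. x t) \<in> borel_measurable (\<Pi>\<^sub>M i\<in>{..<Suc t}. borel)"
      by (rule measurable_component_singleton) simp
    have "(\<lambda>x. (queue_weight w \<gamma> (S t x), x t)) \<in> measurable (\<Pi>\<^sub>M i\<in>{..<Suc t}. borel) (borel \<Otimes>\<^sub>M borel)"
      by measurable
    from measurable_compose[OF this h_pair] show ?case
      unfolding SS by (rule borel_measurable_add[rotated]) measurable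
  qed (simp add: S0)
  have soc_eq: "AE \<omega> in M. \<forall>t. soc G (\<lambda>k. b k \<omega>) t = S t (\<lambda>i. X i \<omega>)"
    using b_eq
  proof eventually_elim
    case (elim \<omega>)
    show ?case
    proof
      show "soc G (\<lambda>k. b k \<omega>) t = S t (\<lambda>i. X i \<omega>)" for t
      proof (induction t)
        case (Suc t)
        have "b t \<omega> = h (queue_weight w \<gamma> (S t (\<lambda>i. X i \<omega>)), X t \<omega>)"
          using elim[THEN spec, of t] unfolding Suc .
        then show ?case
          by (simp add: SS Suc)
      qed (simp add: S0)
    qed
  qed
  \<comment> \<open>Past and present are restrictions of one independent family to disjoint index
    sets; the present is thus a product over a singleton, evaluated at \<open>t\<close>.\<close>
  let ?N1 = "PiM {..<t} (\<lambda>_. borel :: 'n data measure)" and ?N2 = "PiM {t} (\<lambda>_. borel :: 'n data measure)"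
  let ?U = "\<lambda>\<omega>. restrict (\<lambda>i. X i \<omega>) {..<t}" and ?W = "\<lambda>\<omega>. restrict (\<lambda>i. X i \<omega>) {t}"
  let ?m = "\<lambda>p. fst p \<bullet> h p + agg_cost (sig_of (snd p)) (h p)"
  let ?g = "\<lambda>p. ?m (queue_weight w \<gamma> (S t (fst p)), snd p t)"
  have m: "?m \<in> borel_measurable (borel \<Otimes>\<^sub>M borel)"
    using h_pair by (intro borel_measurable_add borel_measurable_inner measurable_agg_cost measurable_fst measurable_snd)
  have [measurable]: "S t \<in> borel_measurable ?N1"
    by (rule S_meas)
  have [measurable]: "(\<lambda>x. x t) \<in> borel_measurable ?N2"
    by (rule measurable_component_singleton) simp
  have "(\<lambda>p. (queue_weight w \<gamma> (S t (fst p)), snd p t)) \<in> measurable (?N1 \<Otimes>\<^sub>M ?N2) (borel \<Otimes>\<^sub>M borel)"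
    by measurable
  from measurable_compose[OF this m] have g: "?g \<in> borel_measurable (?N1 \<Otimes>\<^sub>M ?N2)" .
  have ind: "indep_var ?N1 ?U ?N2 ?W"
    by (rule indep_var_restrict[OF indep_X]) auto
  have cost_eq: "AE \<omega> in M. ?g (?U \<omega>, ?W \<omega>) = ?Y t \<omega> \<bullet> b t \<omega> + agg_cost (\<Xi> t \<omega>) (b t \<omega>)"
    using b_eq soc_eq
  proof eventually_elim
    case (elim \<omega>)
    have "S t (\<lambda>i. X i \<omega>) = soc G (\<lambda>k. b k \<omega>) t"
      by (rule elim(2)[THEN spec, THEN sym])
    moreover have "h (?Y t \<omega>, X t \<omega>) = b t \<omega>"
      by (rule elim(1)[THEN spec, THEN sym])
    ultimately show ?case by (simp add: S_restrict)
  qed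
  have int_b: "integrable M (\<lambda>\<omega>. agg_cost (\<Xi> t \<omega>) (b t \<omega>))"
    by (rule integrable_agg_cost[OF b_meas b_adm])
  have "(\<lambda>\<omega>. (?U \<omega>, ?W \<omega>)) \<in> measurable M (?N1 \<Otimes>\<^sub>M ?N2)"
    by (intro measurable_Pair measurable_restrict measurable_X)
  from measurable_compose[OF this g] have g_UW: "(\<lambda>\<omega>. ?g (?U \<omega>, ?W \<omega>)) \<in> borel_measurable M" .
  have int_Yb: "integrable M (\<lambda>\<omega>. ?Y t \<omega> \<bullet> b t \<omega> + agg_cost (\<Xi> t \<omega>) (b t \<omega>))"
    using \<open>?int\<close> int_b by simp
  have "integrable M (\<lambda>\<omega>. ?g (?U \<omega>, ?W \<omega>))"
    using int_Yb by (subst integrable_cong_AE[OF g_UW _ cost_eq]) auto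
  then have "(\<integral>\<omega>. ?g (?U \<omega>, ?W \<omega>) \<partial>M) \<le> V"
  proof (rule indep_var_expectation_le[OF ind g])
    fix u
    \<comment> \<open>With the past frozen at \<open>u\<close> the queue weight is a constant
      vector, as \<open>weak_duality\<close> requires of its multiplier.\<close>
    define y where "y = queue_weight w \<gamma> (S t u)"
    have Pair_y: "(\<lambda>x. (y, x)) \<in> measurable borel (borel \<Otimes>\<^sub>M borel)"
      by measurable
    have hX: "(\<lambda>\<omega>. h (y, X t \<omega>)) \<in> borel_measurable M" for t
      by (rule measurable_compose[OF measurable_X measurable_compose[OF Pair_y h_pair]])
    have adm_h: "AE \<omega> in M. admissible G (\<Xi> t \<omega>) (h (y, X t \<omega>))" for t
      using AE_signal_ok
    proof eventually_elim
      case (elim \<omega>)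
      then show ?case using opt admissible_zero by (metis sig_of_X)
    qed
    have "(\<integral>\<omega>. ?m (y, X t \<omega>) \<partial>M) \<le> V"
    proof (rule weak_duality[OF ref V, where \<phi> = "\<lambda>x. ?m (y, x)" and y = y])
      show "(\<lambda>x. ?m (y, x)) \<in> borel_measurable borel"
        by (rule measurable_compose[OF Pair_y m])
      show "integrable M (\<lambda>\<omega>. ?m (y, X t \<omega>))" for t
        using integrable_inner_admissible[OF _ _ hX adm_h, of "\<lambda>_. y" "norm y"]
          integrable_agg_cost[OF hX adm_h] by simp
      show "?m (y, X t \<omega>) \<le> y \<bullet> c + agg_cost (\<Xi> t \<omega>) c"
        if "signal_ok G (\<Xi> t \<omega>)" "admissible G (\<Xi> t \<omega>) c" for t \<omega> c
      proof -
        have "y \<bullet> h (y, X t \<omega>) + agg_cost (sig_of (X t \<omega>)) (h (y, X t \<omega>))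
            \<le> y \<bullet> c + agg_cost (sig_of (X t \<omega>)) c"
          using opt that by (metis sig_of_X)
        then show ?thesis by simp
      qed
    qed
    then show "(\<integral>\<omega>. ?g (u, ?W \<omega>) \<partial>M) \<le> V"
      by (simp add: y_def)
  qed
  also have "(\<integral>\<omega>. ?g (?U \<omega>, ?W \<omega>) \<partial>M) = (\<integral>\<omega>. ?Y t \<omega> \<bullet> b t \<omega> + agg_cost (\<Xi> t \<omega>) (b t \<omega>) \<partial>M)"
    using int_Yb by (intro integral_cong_AE[OF g_UW _ cost_eq]) auto
  also have "\<dots> = (\<integral>\<omega>. ?Y t \<omega> \<bullet> b t \<omega> \<partial>M) + exp_agg_cost M \<Xi> b t"
    using \<open>?int\<close> int_b by (simp add: exp_agg_cost_def)
  finally show ?le .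
qed

end

subsection \<open>Equilibrium and distance bound\<close>

context storage_game
begin

lemma feasible_convex:
  assumes a: "feasible M G \<Xi> a" and b: "feasible M G \<Xi> b" and u: "0 \<le> u" "u \<le> 1"
  shows "feasible M G \<Xi> (\<lambda>t \<omega>. (1 - u) *\<^sub>R a t \<omega> + u *\<^sub>R b t \<omega>)"
proof -
  have soc: "soc G (\<lambda>k. (1 - u) *\<^sub>R x k + u *\<^sub>R y k) t = (1 - u) *\<^sub>R soc G x t + u *\<^sub>R soc G y t" for x y t
  proof -
    have "s_init G = (1 - u) *\<^sub>R s_init G + u *\<^sub>R s_init G"
      by (rule convex_combination_same[symmetric])
    then show ?thesis
      unfolding soc_eq_sum sum.distrib scaleR_sum_right[symmetric] scaleR_add_right
      by (metis (no_types) add.assoc add.left_commute)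
  qed
  have "AE \<omega> in M. \<forall>t. s_lo G \<le> soc G (\<lambda>k. a k \<omega>) t \<and> soc G (\<lambda>k. a k \<omega>) t \<le> s_hi G \<and>
      admissible G (\<Xi> t \<omega>) (a t \<omega>)"
    and "AE \<omega> in M. \<forall>t. s_lo G \<le> soc G (\<lambda>k. b k \<omega>) t \<and> soc G (\<lambda>k. b k \<omega>) t \<le> s_hi G \<and>
      admissible G (\<Xi> t \<omega>) (b t \<omega>)"
    using a b by (simp_all add: feasible_def)
  then have "AE \<omega> in M. \<forall>t. s_lo G \<le> soc G (\<lambda>k. (1 - u) *\<^sub>R a k \<omega> + u *\<^sub>R b k \<omega>) t \<and>
      soc G (\<lambda>k. (1 - u) *\<^sub>R a k \<omega> + u *\<^sub>R b k \<omega>) t \<le> s_hi G \<and>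
      admissible G (\<Xi> t \<omega>) ((1 - u) *\<^sub>R a t \<omega> + u *\<^sub>R b t \<omega>)"
  proof eventually_elim
    case (elim \<omega>)
    show ?case
    proof
      fix t
      note a = elim(1)[THEN spec, of t] and b = elim(2)[THEN spec, of t]
      show "s_lo G \<le> soc G (\<lambda>k. (1 - u) *\<^sub>R a k \<omega> + u *\<^sub>R b k \<omega>) t \<and>
          soc G (\<lambda>k. (1 - u) *\<^sub>R a k \<omega> + u *\<^sub>R b k \<omega>) t \<le> s_hi G \<and>
          admissible G (\<Xi> t \<omega>) ((1 - u) *\<^sub>R a t \<omega> + u *\<^sub>R b t \<omega>)"
        unfolding soc
        using convex_combination_mono[OF a[THEN conjunct1] b[THEN conjunct1] u]
          convex_combination_mono[OF a[THEN conjunct2, THEN conjunct1] b[THEN conjunct2, THEN conjunct1] u]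
          admissible_convex[OF a[THEN conjunct2, THEN conjunct2] b[THEN conjunct2, THEN conjunct2] u]
        unfolding convex_combination_same by blast
    qed
  qed
  moreover have "(\<lambda>\<omega>. (1 - u) *\<^sub>R a t \<omega> + u *\<^sub>R b t \<omega>) \<in> borel_measurable M" for t
    using feasible_measurable[OF a, of t] feasible_measurable[OF b, of t] by measurable
  ultimately show ?thesis
    by (simp add: feasible_def)
qed

lemma integrable_norm_diff_power2:
  assumes a: "feasible M G \<Xi> a" and b: "feasible M G \<Xi> b"
  shows "integrable M (\<lambda>\<omega>. (norm (b t \<omega> - a t \<omega>))\<^sup>2)"
proof -
  obtain R where R: "0 \<le> R" "\<forall>v. b_lo G \<le> v \<and> v \<le> b_hi G \<longrightarrow> norm v \<le> R"
    using bounded_interval_vec by blast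
  have "AE \<omega> in M. norm ((norm (b t \<omega> - a t \<omega>))\<^sup>2) \<le> (2 * R)\<^sup>2"
    using feasible_admissible[OF a, of t] feasible_admissible[OF b, of t]
  proof eventually_elim
    case (elim \<omega>)
    then have "norm (a t \<omega>) \<le> R" "norm (b t \<omega>) \<le> R"
      using R unfolding admissible_def by blast+
    then have "norm (b t \<omega> - a t \<omega>) \<le> 2 * R"
      using norm_triangle_ineq4[of "b t \<omega>" "a t \<omega>"] by linarith
    then have "(norm (b t \<omega> - a t \<omega>))\<^sup>2 \<le> (2 * R)\<^sup>2"
      by (rule power_mono) simp
    then show ?case
      by (simp only: real_norm_def abs_power2)
  qed
  moreover have "(\<lambda>\<omega>. (norm (b t \<omega> - a t \<omega>))\<^sup>2) \<in> borel_measurable M"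
    using feasible_measurable[OF a, of t] feasible_measurable[OF b, of t] by measurable
  ultimately show ?thesis
    by (rule integrable_const_bound)
qed

text \<open>Of the exact convexity defect only the squared distance is kept, with \<open>cp\<close>
  replaced by its lower bound.\<close>

lemma time_avg_strongly_convex:
  assumes a: "feasible M G \<Xi> a" and b: "feasible M G \<Xi> b" and u: "0 \<le> u" "u \<le> 1"
  shows "time_avg (exp_agg_cost M \<Xi> (\<lambda>t \<omega>. (1 - u) *\<^sub>R a t \<omega> + u *\<^sub>R b t \<omega>)) T
      + u * (1 - u) * (cp_lo G / 2) * time_avg (\<lambda>t. \<integral>\<omega>. (norm (b t \<omega> - a t \<omega>))\<^sup>2 \<partial>M) T
    \<le> (1 - u) * time_avg (exp_agg_cost M \<Xi> a) T + u * time_avg (exp_agg_cost M \<Xi> b) T"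
proof -
  let ?m = "\<lambda>t \<omega>. (1 - u) *\<^sub>R a t \<omega> + u *\<^sub>R b t \<omega>"
  let ?D = "\<lambda>t. \<integral>\<omega>. (norm (b t \<omega> - a t \<omega>))\<^sup>2 \<partial>M"
  note m = feasible_convex[OF a b u]
  have int: "integrable M (\<lambda>\<omega>. agg_cost (\<Xi> t \<omega>) (c t \<omega>))" if "feasible M G \<Xi> c" for c t
    by (rule integrable_agg_cost[OF feasible_measurable[OF that] feasible_admissible[OF that]])
  have step: "exp_agg_cost M \<Xi> ?m t + u * (1 - u) * (cp_lo G / 2) * ?D t
      \<le> (1 - u) * exp_agg_cost M \<Xi> a t + u * exp_agg_cost M \<Xi> b t" for t
  proof -
    have "(\<integral>\<omega>. agg_cost (\<Xi> t \<omega>) (?m t \<omega>) + u * (1 - u) * (cp_lo G / 2) * (norm (b t \<omega> - a t \<omega>))\<^sup>2 \<partial>M)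
      \<le> (\<integral>\<omega>. (1 - u) * agg_cost (\<Xi> t \<omega>) (a t \<omega>) + u * agg_cost (\<Xi> t \<omega>) (b t \<omega>) \<partial>M)"
    proof (rule integral_mono_AE)
      show "AE \<omega> in M. agg_cost (\<Xi> t \<omega>) (?m t \<omega>) + u * (1 - u) * (cp_lo G / 2) * (norm (b t \<omega> - a t \<omega>))\<^sup>2
        \<le> (1 - u) * agg_cost (\<Xi> t \<omega>) (a t \<omega>) + u * agg_cost (\<Xi> t \<omega>) (b t \<omega>)"
        using AE_signal_ok
      proof eventually_elim
        case (elim \<omega>)
        have "cp_lo G / 2 * (norm (b t \<omega> - a t \<omega>))\<^sup>2 \<le> cost_gap (\<Xi> t \<omega>) (b t \<omega> - a t \<omega>)"
          using elim grid by (intro cost_gap_ge) (auto simp: signal_ok_def grid_ok_def)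
        then have "u * (1 - u) * (cp_lo G / 2 * (norm (b t \<omega> - a t \<omega>))\<^sup>2)
            \<le> u * (1 - u) * cost_gap (\<Xi> t \<omega>) (b t \<omega> - a t \<omega>)"
          using u by (intro mult_left_mono) auto
        then show ?case
          unfolding agg_cost_convex_combination by (simp add: mult.assoc)
      qed
    qed (use int[OF a] int[OF b] int[OF m] integrable_norm_diff_power2[OF a b] in auto)
    then show ?thesis
      using int[OF a] int[OF b] int[OF m] integrable_norm_diff_power2[OF a b]
      by (simp add: exp_agg_cost_def)
  qed
  have "(\<Sum>t<T. exp_agg_cost M \<Xi> ?m t) + u * (1 - u) * (cp_lo G / 2) * (\<Sum>t<T. ?D t)
      \<le> (1 - u) * (\<Sum>t<T. exp_agg_cost M \<Xi> a t) + u * (\<Sum>t<T. exp_agg_cost M \<Xi> b t)"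
    using sum_mono[of "{..<T}", OF step] unfolding sum.distrib sum_distrib_left[symmetric] .
  from divide_right_mono[OF this, of "real T"] show ?thesis
    by (simp add: time_avg_def add_divide_distrib)
qed

text \<open>Telescopes half the weighted sum of the squared virtual queues.\<close>

lemma sum_queue_weight_ge:
  assumes w: "\<And>n. 0 < w $ n" and b: "\<And>t. b_lo G \<le> b t \<and> b t \<le> b_hi G"
  shows "- (1/2 * (\<Sum>n\<in>UNIV. w $ n * (s_init G $ n + \<gamma> $ n)\<^sup>2)) - real T * K_const G w
    \<le> (\<Sum>t<T. queue_weight w \<gamma> (soc G b t) \<bullet> b t)"
proof -
  define L where "L s = 1/2 * (\<Sum>n\<in>UNIV. w $ n * (s $ n + \<gamma> $ n)\<^sup>2)" for s
  \<comment> \<open>Expanding the squared queue gives the queue weight times the charge, plus half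
    the weighted squared charge. The latter is at most \<open>K_const G w\<close>, since a square on
    an interval is largest at an endpoint.\<close>
  have step: "L (soc G b (Suc t)) \<le> L (soc G b t) + queue_weight w \<gamma> (soc G b t) \<bullet> b t + K_const G w" for t
  proof -
    let ?s = "soc G b t"
    have "L (?s + b t) = (\<Sum>n\<in>UNIV. 1/2 * (w $ n * (?s $ n + \<gamma> $ n)\<^sup>2) + w $ n * (?s $ n + \<gamma> $ n) * b t $ n
        + 1/2 * (w $ n * (b t $ n)\<^sup>2))"
      unfolding L_def sum_distrib_left by (intro sum.cong) (auto simp: field_simps power2_eq_square)
    also have "\<dots> = L ?s + queue_weight w \<gamma> ?s \<bullet> b t + 1/2 * (\<Sum>n\<in>UNIV. w $ n * (b t $ n)\<^sup>2)"
      unfolding L_def queue_weight_inner sum.distrib sum_distrib_left ..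
    also have "(\<Sum>n\<in>UNIV. w $ n * (b t $ n)\<^sup>2) \<le> (\<Sum>n\<in>UNIV. w $ n * max ((b_hi G $ n)\<^sup>2) ((b_lo G $ n)\<^sup>2))"
    proof (rule sum_mono)
      fix n
      have lo: "b_lo G $ n \<le> b t $ n" and hi: "b t $ n \<le> b_hi G $ n"
        using b[of t] by (auto simp: less_eq_vec_def)
      have "(b t $ n)\<^sup>2 \<le> max ((b_hi G $ n)\<^sup>2) ((b_lo G $ n)\<^sup>2)"
      proof (cases "0 \<le> b t $ n")
        case True
        then have "(b t $ n)\<^sup>2 \<le> (b_hi G $ n)\<^sup>2" using hi by (intro power_mono) auto
        then show ?thesis by simp
      next
        case False
        then have "(- (b t $ n))\<^sup>2 \<le> (- (b_lo G $ n))\<^sup>2" using lo by (intro power_mono) auto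
        then show ?thesis by simp
      qed
      then show "w $ n * (b t $ n)\<^sup>2 \<le> w $ n * max ((b_hi G $ n)\<^sup>2) ((b_lo G $ n)\<^sup>2)"
        using w[of n] by (intro mult_left_mono) auto
    qed
    finally show ?thesis
      by (simp add: K_const_def)
  qed
  have acc: "L (soc G b T) \<le> L (s_init G) + (\<Sum>t<T. queue_weight w \<gamma> (soc G b t) \<bullet> b t) + real T * K_const G w" for T
  proof (induction T)
    case (Suc T)
    then show ?case using step[of T] by (simp add: algebra_simps)
  qed simp
  have "0 \<le> L (soc G b T)"
    using w unfolding L_def by (intro mult_nonneg_nonneg sum_nonneg) (auto simp: less_imp_le)
  with acc[of T] have "- L (s_init G) - real T * K_const G w \<le> (\<Sum>t<T. queue_weight w \<gamma> (soc G b t) \<bullet> b t)"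
    by linarith
  then show ?thesis
    unfolding L_def .
qed

text \<open>Summing the bounds of single periods leaves the total drift, which is at least minus the
  initial queue energy \<open>L\<close> minus \<open>T\<close> times \<open>K_const G w\<close>; the
  former disappears in the average.\<close>

lemma real_time_time_avg_le:
  assumes w: "\<And>n. 0 < w $ n"
    and rt: "real_time_decisions M G \<Xi> w \<gamma> b" and feas: "feasible M G \<Xi> b"
    and ref: "feasible M G \<Xi> b_ref" and V: "time_avg (exp_agg_cost M \<Xi> b_ref) \<longlonglongrightarrow> V"
  shows "\<exists>L. \<forall>T>0. time_avg (exp_agg_cost M \<Xi> b) T \<le> V + K_const G w + L / real T"
proof -
  let ?q = "\<lambda>t \<omega>. queue_weight w \<gamma> (soc G (\<lambda>k. b k \<omega>) t) \<bullet> b t \<omega>"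
  define L where "L = 1/2 * (\<Sum>n\<in>UNIV. w $ n * (s_init G $ n + \<gamma> $ n)\<^sup>2)"
  note cost = real_time_cost_le[OF rt feas ref V]
  have drift: "- L - real T * K_const G w \<le> (\<Sum>t<T. \<integral>\<omega>. ?q t \<omega> \<partial>M)" for T
  proof -
    have "- L - real T * K_const G w \<le> (\<integral>\<omega>. (\<Sum>t<T. ?q t \<omega>) \<partial>M)"
    proof (rule integral_ge_const)
      show "integrable M (\<lambda>\<omega>. \<Sum>t<T. ?q t \<omega>)"
        using cost(1) by auto
      have "AE \<omega> in M. \<forall>t. admissible G (\<Xi> t \<omega>) (b t \<omega>)"
        using feasible_admissible[OF feas] by (simp add: AE_all_countable)
      then show "AE \<omega> in M. - L - real T * K_const G w \<le> (\<Sum>t<T. ?q t \<omega>)"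
      proof eventually_elim
        case (elim \<omega>)
        show ?case
          unfolding L_def by (rule sum_queue_weight_ge[OF w]) (use elim in \<open>auto simp: admissible_def\<close>)
      qed
    qed
    also have "\<dots> = (\<Sum>t<T. \<integral>\<omega>. ?q t \<omega> \<partial>M)"
      using cost(1) by (intro Bochner_Integration.integral_sum) auto
    finally show ?thesis .
  qed
  have "time_avg (exp_agg_cost M \<Xi> b) T \<le> V + K_const G w + L / real T" if "0 < T" for T
  proof -
    have "(\<Sum>t<T. (\<integral>\<omega>. ?q t \<omega> \<partial>M) + exp_agg_cost M \<Xi> b t) \<le> (\<Sum>t<T. V)"
      by (rule sum_mono[OF cost(2)])
    then have "(\<Sum>t<T. exp_agg_cost M \<Xi> b t) \<le> real T * V + L + real T * K_const G w"
      using drift[of T] unfolding sum.distrib by simp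
    then show ?thesis
      using that by (simp add: time_avg_def field_simps)
  qed
  then show ?thesis by blast
qed

section \<open>The potential game and the final estimate\<close>

lemma integrable_user_cost:
  assumes b: "feasible M G \<Xi> b"
  shows "integrable M (\<lambda>\<omega>. user_cost (\<Xi> t \<omega>) n (b t \<omega>))"
proof -
  have "continuous_on UNIV (\<lambda>p :: 'n data \<times> (real^'n) \<times> (real^'n).
      (\<lambda>x b b'. user_cost (sig_of x) n b) (fst p) (fst (snd p)) (snd (snd p)))"
    by (intro continuous_intros)
  from bounded_of_continuous[OF this] obtain C where
    C: "\<forall>\<xi> b b'. signal_ok G \<xi> \<longrightarrow> b_lo G \<le> b \<and> b \<le> b_hi G \<longrightarrow>
      b_lo G \<le> b' \<and> b' \<le> b_hi G \<longrightarrow> \<bar>user_cost (sig_of (signal_tuple \<xi>)) n b\<bar> \<le> C"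
    by blast
  have "AE \<omega> in M. norm (user_cost (\<Xi> t \<omega>) n (b t \<omega>)) \<le> C"
    using AE_signal_ok feasible_admissible[OF b, of t]
  proof eventually_elim
    case (elim \<omega>)
    then show ?case
      using C unfolding admissible_def real_norm_def sig_of_signal_tuple by blast
  qed
  moreover have "(\<lambda>\<omega>. user_cost (sig_of (X t \<omega>)) n (b t \<omega>)) \<in> borel_measurable M"
    by (rule borel_measurable_continuous_Pair[OF measurable_X feasible_measurable[OF b]])
      (intro continuous_intros)
  ultimately show ?thesis
    by (intro integrable_const_bound) auto
qed

text \<open>User averages need not converge, so they are compared horizon by horizon: their
  difference equals that of the aggregate averages, of which one converges to \<open>?V\<close> and
  the other is eventually at least \<open>?V\<close> minus any tolerance. The comparison then passes
  to the limit superior.\<close>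

lemma offline_minimizer_is_equilibrium:
  assumes opt: "offline_minimizer M G \<Xi> b"
  shows "gen_nash_equilibrium M G \<Xi> b"
proof -
  have feas: "feasible M G \<Xi> b" and conv: "convergent (time_avg (exp_agg_cost M \<Xi> b))"
    using opt by (auto simp: offline_minimizer_def is_arg_min_def)
  let ?V = "lim (time_avg (exp_agg_cost M \<Xi> b))"
  have V: "time_avg (exp_agg_cost M \<Xi> b) \<longlonglongrightarrow> ?V"
    using conv by (simp add: convergent_LIMSEQ_iff)
  have "long_run_avg (exp_user_cost M \<Xi> n b) \<le> long_run_avg (exp_user_cost M \<Xi> n b')"
    if feas': "feasible M G \<Xi> b'" and same: "AE \<omega> in M. \<forall>t m. m \<noteq> n \<longrightarrow> b' t \<omega> $ m = b t \<omega> $ m" for n b'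
  proof -
    note int_user = integrable_user_cost[OF feas]
    have int: "integrable M (\<lambda>\<omega>. agg_cost (\<Xi> t \<omega>) (c t \<omega>))" if "feasible M G \<Xi> c" for c t
      by (rule integrable_agg_cost[OF feasible_measurable[OF that] feasible_admissible[OF that]])
    have diff: "exp_user_cost M \<Xi> n b' t = exp_user_cost M \<Xi> n b t + exp_agg_cost M \<Xi> b' t - exp_agg_cost M \<Xi> b t" for t
    proof -
      have "exp_user_cost M \<Xi> n b' t = (\<integral>\<omega>. user_cost (\<Xi> t \<omega>) n (b t \<omega>) + agg_cost (\<Xi> t \<omega>) (b' t \<omega>)
          - agg_cost (\<Xi> t \<omega>) (b t \<omega>) \<partial>M)"
        unfolding exp_user_cost_def
      proof (rule integral_cong_AE)
        show "AE \<omega> in M. user_cost (\<Xi> t \<omega>) n (b' t \<omega>) =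
            user_cost (\<Xi> t \<omega>) n (b t \<omega>) + agg_cost (\<Xi> t \<omega>) (b' t \<omega>) - agg_cost (\<Xi> t \<omega>) (b t \<omega>)"
          using same
        proof eventually_elim
          case (elim \<omega>)
          have "user_cost (\<Xi> t \<omega>) n (b' t \<omega>) - user_cost (\<Xi> t \<omega>) n (b t \<omega>) =
              agg_cost (\<Xi> t \<omega>) (b' t \<omega>) - agg_cost (\<Xi> t \<omega>) (b t \<omega>)"
            using elim by (intro user_cost_diff_eq_agg_cost_diff) auto
          then show ?case by simp
        qed
        show "(\<lambda>\<omega>. user_cost (\<Xi> t \<omega>) n (b t \<omega>) + agg_cost (\<Xi> t \<omega>) (b' t \<omega>) - agg_cost (\<Xi> t \<omega>) (b t \<omega>))
            \<in> borel_measurable M"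
          using int_user[of t n] int[OF feas, of t] int[OF feas', of t] by (intro borel_measurable_diff borel_measurable_add) auto
      qed (use integrable_user_cost[OF feas', of t n] in auto)
      then show ?thesis
        using int_user[of t n] int[OF feas, of t] int[OF feas', of t]
        by (simp add: exp_user_cost_def exp_agg_cost_def)
    qed
    have avg: "time_avg (exp_user_cost M \<Xi> n b') T =
        time_avg (exp_user_cost M \<Xi> n b) T + time_avg (exp_agg_cost M \<Xi> b') T - time_avg (exp_agg_cost M \<Xi> b) T" for T
      unfolding time_avg_def diff
      by (simp add: sum.distrib sum_subtractf add_divide_distrib diff_divide_distrib)
    show ?thesis
    proof (rule ereal_le_epsilon2)
      fix e :: real assume e: "0 < e"
      have "\<forall>\<^sub>F T in sequentially. ?V - e / 2 \<le> time_avg (exp_agg_cost M \<Xi> b') T"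
        by (rule offline_value_le_time_avg[OF opt feas']) (use e in simp)
      moreover have "\<forall>\<^sub>F T in sequentially. time_avg (exp_agg_cost M \<Xi> b) T < ?V + e / 2"
        by (rule order_tendstoD(2)[OF V]) (use e in simp)
      ultimately have "\<forall>\<^sub>F T in sequentially. ereal (time_avg (exp_user_cost M \<Xi> n b) T) \<le>
          ereal (time_avg (exp_user_cost M \<Xi> n b') T) + ereal e"
        by eventually_elim (simp add: avg)
      from Limsup_mono[OF this]
      show "long_run_avg (exp_user_cost M \<Xi> n b) \<le> long_run_avg (exp_user_cost M \<Xi> n b') + ereal e"
        unfolding long_run_avg_def by (subst (asm) Limsup_add_ereal_right) auto
    qed
  qed
  then show ?thesis
    using feas by (auto simp: gen_nash_equilibrium_def)
qed

text \<open>The offline optimum is mixed with a small weight \<open>u\<close> of the real-time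
  decisions. Relative to \<open>?V\<close>, the interpolated cost exceeds by at most
  \<open>u * K\<close>, up to vanishing errors, and must cover \<open>u * (1 - u) * c\<close> times
  the average squared distance. Equal weights would give only twice the bound; the stated constant
  arises as \<open>u\<close> tends to 0.\<close>

lemma real_time_distance:
  assumes w: "\<And>n. 0 < w $ n"
    and rt: "real_time_decisions M G \<Xi> w \<gamma> b" and feas: "feasible M G \<Xi> b"
    and opt: "offline_minimizer M G \<Xi> b_opt"
  shows "long_run_avg (\<lambda>t. \<integral>\<omega>. (norm (b t \<omega> - b_opt t \<omega>))\<^sup>2 \<partial>M) \<le> ereal (2 * K_const G w / cp_lo G)"
proof (rule ereal_le_epsilon2)
  fix e :: real assume e: "0 < e"
  have feas': "feasible M G \<Xi> b_opt" and conv: "convergent (time_avg (exp_agg_cost M \<Xi> b_opt))"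
    using opt by (auto simp: offline_minimizer_def is_arg_min_def)
  let ?V = "lim (time_avg (exp_agg_cost M \<Xi> b_opt))"
  let ?D = "time_avg (\<lambda>t. \<integral>\<omega>. (norm (b t \<omega> - b_opt t \<omega>))\<^sup>2 \<partial>M)"
  have V: "time_avg (exp_agg_cost M \<Xi> b_opt) \<longlonglongrightarrow> ?V"
    using conv by (simp add: convergent_LIMSEQ_iff)
  obtain L where L: "\<forall>T>0. time_avg (exp_agg_cost M \<Xi> b) T \<le> ?V + K_const G w + L / real T"
    using real_time_time_avg_le[OF w rt feas feas' V] by blast
  define K where "K = K_const G w"
  have K: "0 \<le> K"
    unfolding K_def K_const_def using w
    by (intro mult_nonneg_nonneg sum_nonneg) (auto simp: less_imp_le le_max_iff_disj)
  define c where "c = cp_lo G / 2"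
  have c: "0 < c"
    using grid by (simp add: c_def grid_ok_def)
  have ce: "0 < c * e"
    using c e by simp
  \<comment> \<open>Solves \<open>(1 - u) * (K + c * e) = K + c * e / 2\<close>: half of the
    tolerance pays for the factor \<open>1 - u\<close>, and \<open>u * c * e / 2\<close> is left for
    the errors, which amount to \<open>2 * \<eta>\<close>.\<close>
  define u where "u = (c * e / 2) / (K + c * e)"
  have u: "0 < u" "u < 1" and u_eq: "(1 - u) * (K + c * e) = K + c * e / 2"
    using ce K by (auto simp: u_def field_simps)
  define \<eta> where "\<eta> = u * (c * e) / 6"
  have \<eta>: "0 < \<eta>"
    using u ce by (simp add: \<eta>_def)
  let ?m = "\<lambda>t \<omega>. (1 - u) *\<^sub>R b_opt t \<omega> + u *\<^sub>R b t \<omega>"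
  have feas_m: "feasible M G \<Xi> ?m"
    using u by (intro feasible_convex feas feas') auto
  have "\<forall>\<^sub>F T in sequentially. ?V - \<eta> \<le> time_avg (exp_agg_cost M \<Xi> ?m) T"
    by (rule offline_value_le_time_avg[OF opt feas_m]) (use \<eta> in simp)
  moreover have "\<forall>\<^sub>F T in sequentially. time_avg (exp_agg_cost M \<Xi> b_opt) T < ?V + \<eta>"
    by (rule order_tendstoD(2)[OF V]) (use \<eta> in simp)
  moreover have "\<forall>\<^sub>F T in sequentially. L / real T < \<eta>"
    by (rule order_tendstoD(2)[OF lim_const_over_n \<eta>])
  ultimately have "\<forall>\<^sub>F T in sequentially. ereal (?D T) \<le> ereal (2 * K_const G w / cp_lo G + e)"
    using eventually_gt_at_top[of 0]
  proof eventually_elim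
    case (elim T)
    have "time_avg (exp_agg_cost M \<Xi> b) T \<le> ?V + K + \<eta>"
      using L[rule_format, OF elim(4)] elim(3) unfolding K_def by linarith
    then have "u * time_avg (exp_agg_cost M \<Xi> b) T \<le> u * (?V + K + \<eta>)"
      using u by (intro mult_left_mono) auto
    moreover have "(1 - u) * time_avg (exp_agg_cost M \<Xi> b_opt) T \<le> (1 - u) * (?V + \<eta>)"
      using u elim by (intro mult_left_mono) auto
    moreover have "time_avg (exp_agg_cost M \<Xi> ?m) T + u * (1 - u) * c * ?D T
        \<le> (1 - u) * time_avg (exp_agg_cost M \<Xi> b_opt) T + u * time_avg (exp_agg_cost M \<Xi> b) T"
      using time_avg_strongly_convex[OF feas' feas, of u T] u by (simp add: c_def)
    ultimately have "u * (1 - u) * c * ?D T \<le> (1 - u) * (?V + \<eta>) + u * (?V + K + \<eta>) - (?V - \<eta>)"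
      using elim(1) by linarith
    also have "\<dots> = u * K + 2 * \<eta>"
      by (simp add: algebra_simps)
    also have "\<dots> \<le> u * (K + c * e / 2)"
      using mult_pos_pos[OF u(1) ce] by (simp add: \<eta>_def algebra_simps)
    also have "\<dots> = u * (1 - u) * c * (K / c + e)"
      unfolding u_eq[symmetric] using c by (simp add: field_simps)
    finally have "u * (1 - u) * c * ?D T \<le> u * (1 - u) * c * (K / c + e)" .
    then have "?D T \<le> K / c + e"
      by (rule mult_left_le_imp_le) (use u c in simp)
    then show ?case
      by (simp add: K_def c_def mult.commute)
  qed
  from Limsup_bounded[OF this]
  show "long_run_avg (\<lambda>t. \<integral>\<omega>. (norm (b t \<omega> - b_opt t \<omega>))\<^sup>2 \<partial>M) \<le> ereal (2 * K_const G w / cp_lo G) + ereal e"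
    unfolding long_run_avg_def by simp
qed

end

theorem theorem4:
  fixes M :: "'w measure"
    and G :: "('n::finite) grid"
    and \<Xi> :: "nat \<Rightarrow> 'w \<Rightarrow> 'n signal"
    and w \<gamma> :: "real^'n"
    and b_hat b_tilde :: "nat \<Rightarrow> 'w \<Rightarrow> real^'n"
  assumes "prob_space M"
    and "grid_ok G"
    and "iid_signals M G \<Xi>"
    and "tuned G w \<gamma>"
    and "real_time_decisions M G \<Xi> w \<gamma> b_hat"
    and "feasible M G \<Xi> b_hat"
    and "offline_minimizer M G \<Xi> b_tilde"
    and "price_positive M \<Xi> b_hat"
    and "price_positive M \<Xi> b_tilde"
  shows "gen_nash_equilibrium M G \<Xi> b_tilde \<and>
    long_run_avg (\<lambda>t. \<integral>\<omega>. (norm (b_hat t \<omega> - b_tilde t \<omega>))\<^sup>2 \<partial>M) \<le> ereal (2 * K_const G w / cp_lo G)"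
proof -
  interpret prob_space M by fact
  interpret storage_game G M \<Xi>
    by unfold_locales fact+
  have "0 < w $ n" for n
    using \<open>tuned G w \<gamma>\<close> by (simp add: tuned_def)
  then show ?thesis
    using offline_minimizer_is_equilibrium real_time_distance assms by blast
qed

end
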